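(* Let $0<\tau_*,R,T<\infty$. Suppose that the Cauchy problem for the Boltzmann equation with initial datum $f_0$ has a mild solution $f$ on $[0,T]$ with $f(t)\in\mathbf{M}_{\tau_*,+}$ and $$\|f(t)\|_{\mathbf{M}_{\tau_*}}\le R,\qquad0\le t\le T.$$ If there is a constant $M_0>0$ such that $f_0\in\mathcal{M}_{\tau_*}(R,M_0)$, then, for any $0<\tau_1<\tau_*$, there are two numbers, $0<\tau<\tau_*$ (depending on $T,\tau_*$ and $\tau_1$) and $0<M<\infty$ (depending on $R,M_0,T,\tau_*,\tau_1$ and $\Lambda=(b_0,\lambda)$), such that $$f(t)\in\mathcal{M}_\tau(R,M),\qquad0\le t\le T.$$
   Context: Collision operator. $b(|\mathbf{v}-\mathbf{v}_*|,\boldsymbol{\omega})\ge0$ is a given function depending only on $|\mathbf{v}-\mathbf{v}_*|$ and the scalar product $(\mathbf{v}-\mathbf{v}_* )\cdot\boldsymbol{\omega}$ ($\mathbf{v},\mathbf{v}_*\in\mathbb{R}^3$, $\boldsymbol{\omega}\in\mathbb{S}^2$). Throughout, there are constants $b_0>0$ and $0\le\lambda<2$ with $\int_{\mathbb{S}^2}b(|\mathbf{v}-\mathbf{v}_*|,\boldsymbol{\omega})\,d\boldsymbol{\omega}\le b_0|\mathbf{v}-\mathbf{v}_*|^{-\lambda}$; $\Lambda:=(b_0,\lambda)$. With $\mathbf{v}'=\mathbf{v}-((\mathbf{v}-\mathbf{v}_* )\cdot\boldsymbol{\omega})\boldsymbol{\omega}$, $\mathbf{v}'_*=\mathbf{v}_*+((\mathbf{v}-\mathbf{v}_*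 )\cdot\boldsymbol{\omega})\boldsymbol{\omega}$, $$J(g)(\mathbf{x},\mathbf{v})=\int_{\mathbb{R}^3\times\mathbb{S}^2}b(|\mathbf{v}-\mathbf{v}_*|,\boldsymbol{\omega})\,[g(\mathbf{x},\mathbf{v}')g(\mathbf{x},\mathbf{v}'_* )-g(\mathbf{x},\mathbf{v})g(\mathbf{x},\mathbf{v}_* )]\,d\mathbf{v}_*d\boldsymbol{\omega}.$$ Spaces. $\mathbb{L}^1:=\mathbb{L}^1(\mathbb{R}^3\times\mathbb{R}^3;d\mathbf{x}d\mathbf{v})$ and $\mathbb{L}^\infty:=\mathbb{L}^\infty(\mathbb{R}^3\times\mathbb{R}^3;d\mathbf{x}d\mathbf{v})$ (real). For $\alpha\ge0,\tau>0$, $m_{\alpha,\tau}(\mathbf{x},\mathbf{v}):=\exp(-\alpha\mathbf{x}^2-\tau\mathbf{v}^2)$. $\mathbf{M}_\tau$ is the space of $g\in\mathbb{L}^\infty$ with $\|g\|_{\mathbf{M}_\tau}:=\|m_{\tau,\tau}^{-1}g\|_{\mathbb{L}^\infty}<\infty$, and $\mathbf{M}_{\tau,+}$ is its positive cone. $(T_{\mathbf{y}}g)(\mathbf{x},\mathbf{v}):=g(\mathbf{x}+\mathbf{y},\mathbf{v})$. For $0<R,M<\infty$, $\mathcal{M}_\tau(R,M)$ is the set of $g\in\mathbf{M}_\tau$ with $\|g\|_{\mathbf{M}_\tau}\le R$ and $\|T_{\mathbf{y}}g-g\|_{\mathbf{M}_\tau}\le M|\mathbf{y}|$ for all $|\mathbf{y}|\le1$.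 Mild solution. $(U^tg)(\mathbf{x},\mathbf{v}):=g(\mathbf{x}-t\mathbf{v},\mathbf{v})$, $t\in\mathbb{R}$. The Cauchy problem is $\partial_tf+\mathbf{v}\cdot\nabla_{\mathbf{x}}f=J(f)$ on $\mathbb{R}^3\times\mathbb{R}^3$, $f(0)=f_0$. A mild solution on $[0,T]$ is $f\in C([0,T];\mathbb{L}^1)$ satisfying $f(t)=U^tf_0+\int_0^tU^{t-s}J(f(s))\,ds$, with the integral a Riemann integral in $\mathbb{L}^1$ and $J$ defined on its natural domain in $\mathbb{L}^1$. *)

theory Defs
  imports "HOL-Analysis.Analysis" "HOL-Probability.Essential_Supremum"
begin

type_synonym vec3 = "real ^ 3"

text \<open>A phase-space point is a pair (position, velocity).\<close>
type_synonym phase = "vec3 \<times> vec3"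

section \<open>Surface measure on the unit sphere\<close>

text \<open>
  Surface measure obtained from polar coordinates: the measure of \<open>A\<close> is the dimension times
  the volume of the cone of all \<open>r\<omega>\<close> with \<open>0 < r < 1\<close> and \<open>\<omega> \<in> A\<close>. It is a measure on the
  Borel sets of the whole space, concentrated on the unit sphere
  (\<open>sgn x = x /\<^sub>R norm x\<close>, and the origin is negligible).
\<close>
definition sphere_measure :: "'a::euclidean_space measure" where
  "sphere_measure =
     distr (density lborel (\<lambda>x. ennreal (real DIM('a)) * indicator (ball 0 1) x)) borel sgn"

lemma sets_sphere_measure [simp, measurable_cong]: "sets sphere_measure = sets borel"
  by (simp add: sphere_measure_def)

lemma space_sphere_measure [simp]: "space sphere_measure = UNIV"
  by (simp add: sphere_measure_def)

lemma borel_measurable_sgn_euclidean: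
  "(sgn :: 'a::euclidean_space \<Rightarrow> 'a) \<in> borel_measurable borel"
  unfolding sgn_div_norm by measurable

lemma AE_sphere_measure_norm: "AE w in (sphere_measure :: 'a::euclidean_space measure). norm w = 1"
proof -
  have dens: "(\<lambda>x::'a. ennreal (real DIM('a)) * indicator (ball 0 1) x) \<in> borel_measurable lborel"
    by (intro borel_measurable_times_ennreal borel_measurable_const borel_measurable_indicator) simp
  have "AE x in (lborel :: 'a measure). x \<noteq> 0"
    by (rule AE_lborel_singleton)
  then have "AE x in density lborel
      (\<lambda>x::'a. ennreal (real DIM('a)) * indicator (ball 0 1) x). norm (sgn x) = 1"
    unfolding AE_density[OF dens] by eventually_elim (simp add: norm_sgn)
  then show ?thesis
    unfolding sphere_measure_def
    by (subst AE_distr_iff) (simp_all add: borel_measurable_sgn_euclidean)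
qed

lemma emeasure_sphere_measure_UNIV:
  "emeasure (sphere_measure :: vec3 measure) UNIV = ennreal (4 * pi)"
proof -
  have dens: "(\<lambda>x::vec3. ennreal 3 * indicator (ball 0 1) x) \<in> borel_measurable lborel"
    by (intro borel_measurable_times_ennreal borel_measurable_const borel_measurable_indicator) simp
  have "emeasure (sphere_measure :: vec3 measure) UNIV
      = emeasure (density lborel (\<lambda>x::vec3. ennreal 3 * indicator (ball 0 1) x)) UNIV"
    unfolding sphere_measure_def
    by (subst emeasure_distr) (simp_all add: borel_measurable_sgn_euclidean)
  also have "\<dots> = (\<integral>\<^sup>+x. ennreal 3 * indicator (ball 0 1) (x::vec3) \<partial>lborel)"
    by (subst emeasure_density[OF dens]) simp_all
  also have "\<dots> = ennreal 3 * emeasure lborel (ball (0::vec3) 1)"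
    by (rule nn_integral_cmult_indicator) simp
  also have "\<dots> = ennreal (4 * pi)"
    by (simp add: emeasure_ball eval_unit_ball_vol flip: ennreal_mult ennreal_numeral)
  finally show ?thesis .
qed

section \<open>Function spaces\<close>

text \<open>
  Elements of \<open>L\<^sup>1\<close> and of \<open>L\<^sup>\<infinity>\<close> are represented by Borel functions; equality in these spaces is
  equality almost everywhere, which is the same as vanishing of the seminorms below.
\<close>

definition L1 :: "(phase \<Rightarrow> real) set" where
  "L1 = {g. integrable lborel g}"

definition L1_norm :: "(phase \<Rightarrow> real) \<Rightarrow> real" where
  "L1_norm g = (\<integral>z. \<bar>g z\<bar> \<partial>lborel)"

definition Linf_norm :: "(phase \<Rightarrow> real) \<Rightarrow> ereal" where
  "Linf_norm g = esssup lborel (\<lambda>z. ereal \<bar>g z\<bar>)"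

definition Linf :: "(phase \<Rightarrow> real) set" where
  "Linf = {g. g \<in> borel_measurable lborel \<and> Linf_norm g < \<infinity>}"

definition gauss_weight :: "real \<Rightarrow> real \<Rightarrow> phase \<Rightarrow> real" where
  "gauss_weight \<alpha> \<tau> = (\<lambda>(x, v). exp (- \<alpha> * (norm x)\<^sup>2 - \<tau> * (norm v)\<^sup>2))"

definition Maxw_norm :: "real \<Rightarrow> (phase \<Rightarrow> real) \<Rightarrow> ereal" where
  "Maxw_norm \<tau> g = Linf_norm (\<lambda>z. inverse (gauss_weight \<tau> \<tau> z) * g z)"

definition Maxw :: "real \<Rightarrow> (phase \<Rightarrow> real) set" where
  "Maxw \<tau> = {g \<in> Linf. Maxw_norm \<tau> g < \<infinity>}"

definition Maxw_pos :: "real \<Rightarrow> (phase \<Rightarrow> real) set" where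
  "Maxw_pos \<tau> = {g \<in> Maxw \<tau>. AE z in lborel. 0 \<le> g z}"

definition translate :: "vec3 \<Rightarrow> (phase \<Rightarrow> real) \<Rightarrow> phase \<Rightarrow> real" where
  "translate y g = (\<lambda>(x, v). g (x + y, v))"

definition Maxw_Lip :: "real \<Rightarrow> real \<Rightarrow> real \<Rightarrow> (phase \<Rightarrow> real) set" where
  "Maxw_Lip \<tau> R M =
     {g \<in> Maxw \<tau>. Maxw_norm \<tau> g \<le> ereal R \<and>
        (\<forall>y. norm y \<le> 1 \<longrightarrow> Maxw_norm \<tau> (\<lambda>z. translate y g z - g z) \<le> ereal (M * norm y))}"

section \<open>Collision operator\<close>

text \<open>
  The kernel is a function \<open>b r s\<close> of \<open>r = |v - v\<^sub>*|\<close> and \<open>s = (v - v\<^sub>*) \<bullet> \<omega>\<close>. The bound is not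
  imposed at \<open>v = v\<^sub>*\<close>, where \<open>|v - v\<^sub>*|\<close> to a negative power is infinite, whereas
  \<open>0 powr a = 0\<close>.
\<close>
definition collision_kernel :: "real \<Rightarrow> real \<Rightarrow> (real \<Rightarrow> real \<Rightarrow> real) \<Rightarrow> bool" where
  "collision_kernel b0 lam b \<longleftrightarrow>
     (\<lambda>(r, s). b r s) \<in> borel_measurable borel \<and>
     (\<forall>r s. 0 \<le> b r s) \<and>
     (\<forall>v vs :: vec3. v \<noteq> vs \<longrightarrow>
        (\<integral>\<^sup>+w. ennreal (b (norm (v - vs)) ((v - vs) \<bullet> w)) \<partial>sphere_measure)
          \<le> ennreal (b0 * norm (v - vs) powr (- lam)))"

definition post_v :: "vec3 \<Rightarrow> vec3 \<Rightarrow> vec3 \<Rightarrow> vec3" where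
  "post_v v vs w = v - ((v - vs) \<bullet> w) *\<^sub>R w"

definition post_vs :: "vec3 \<Rightarrow> vec3 \<Rightarrow> vec3 \<Rightarrow> vec3" where
  "post_vs v vs w = vs + ((v - vs) \<bullet> w) *\<^sub>R w"

definition collision_integrand ::
  "(real \<Rightarrow> real \<Rightarrow> real) \<Rightarrow> (phase \<Rightarrow> real) \<Rightarrow> phase \<Rightarrow> vec3 \<times> vec3 \<Rightarrow> real" where
  "collision_integrand b g = (\<lambda>(x, v) (vs, w).
     b (norm (v - vs)) ((v - vs) \<bullet> w) *
     (g (x, post_v v vs w) * g (x, post_vs v vs w) - g (x, v) * g (x, vs)))"

definition collision_op ::
  "(real \<Rightarrow> real \<Rightarrow> real) \<Rightarrow> (phase \<Rightarrow> real) \<Rightarrow> phase \<Rightarrow> real" where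
  "collision_op b g z =
     (\<integral>p. collision_integrand b g z p \<partial>(lborel \<Otimes>\<^sub>M sphere_measure))"

text \<open>Natural domain in \<open>L\<^sup>1\<close>: the collision integral converges almost everywhere, to an
  integrable function.\<close>
definition collision_dom :: "(real \<Rightarrow> real \<Rightarrow> real) \<Rightarrow> (phase \<Rightarrow> real) set" where
  "collision_dom b =
     {g \<in> L1. (AE z in lborel. integrable (lborel \<Otimes>\<^sub>M sphere_measure) (collision_integrand b g z)) \<and>
        collision_op b g \<in> L1}"

section \<open>Mild solutions\<close>

definition free_flow :: "real \<Rightarrow> (phase \<Rightarrow> real) \<Rightarrow> phase \<Rightarrow> real" where
  "free_flow t g = (\<lambda>(x, v). g (x - t *\<^sub>R v, v))"

definition L1_continuous_on :: "real set \<Rightarrow> (real \<Rightarrow> phase \<Rightarrow> real) \<Rightarrow> bool" where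
  "L1_continuous_on S f \<longleftrightarrow>
     (\<forall>t\<in>S. f t \<in> L1) \<and>
     (\<forall>t\<in>S. ((\<lambda>s. L1_norm (\<lambda>z. f s z - f t z)) \<longlongrightarrow> 0) (at t within S))"

text \<open>Riemann integral in \<open>L\<^sup>1\<close>: the Riemann sums converge in norm as the mesh tends to zero.
  The gauge \<open>\<lambda>s. ball s \<delta>\<close> has the same radius for all tags, so fineness bounds the mesh and no
  Henstock--Kurzweil generality enters.\<close>
definition L1_has_Riemann_integral ::
  "(real \<Rightarrow> phase \<Rightarrow> real) \<Rightarrow> (phase \<Rightarrow> real) \<Rightarrow> real set \<Rightarrow> bool" where
  "L1_has_Riemann_integral F I S \<longleftrightarrow>
     (\<forall>s\<in>S. F s \<in> L1) \<and> I \<in> L1 \<and>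
     (\<forall>\<epsilon>>0. \<exists>\<delta>>0. \<forall>p. p tagged_division_of S \<and> (\<lambda>s. ball s \<delta>) fine p \<longrightarrow>
        L1_norm (\<lambda>z. (\<Sum>(s, K)\<in>p. measure lborel K * F s z) - I z) < \<epsilon>)"

definition mild_solution ::
  "(real \<Rightarrow> real \<Rightarrow> real) \<Rightarrow> real \<Rightarrow> (phase \<Rightarrow> real) \<Rightarrow> (real \<Rightarrow> phase \<Rightarrow> real) \<Rightarrow> bool" where
  "mild_solution b T f0 f \<longleftrightarrow>
     f0 \<in> L1 \<and>
     L1_continuous_on {0..T} f \<and>
     (\<forall>t\<in>{0..T}. f t \<in> collision_dom b) \<and>
     (\<forall>t\<in>{0..T}. \<exists>I.
        L1_has_Riemann_integral (\<lambda>s. free_flow (t - s) (collision_op b (f s))) I {0..t} \<and>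
        (AE z in lborel. f t z = free_flow t f0 z + I z))"

end

theory Submission
  imports Defs "HOL-Real_Asymp.Real_Asymp"
begin

text \<open>
  For a shift \<open>y\<close> put \<open>D(t) = T\<^sub>y f(t) - f(t)\<close>. Since translations commute with free transport and
  with the collision operator \<open>J\<close>, Duhamel's formula gives
  \<open>|D(t)| \<le> U\<^sup>t |D(0)| + \<integral> U\<^sup>t\<^sup>-\<^sup>s |J(T\<^sub>y f(s)) - J(f(s))| ds\<close>, to which Gronwall's
  argument applies as soon as \<open>J\<close> is Lipschitz in a norm that free transport respects. The norm
  with the weight \<open>exp (- \<tau> (x\<^sup>2 + v\<^sup>2))\<close> is not of this kind, because transport moves the weight.

  The remedy is a weight that moves along:
  \<open>W\<^sub>s(x, v) = exp (- \<beta> ((x - s v)\<^sup>2 + v\<^sup>2))\<close>. It satisfies \<open>U\<^sup>t\<^sup>-\<^sup>s W\<^sub>s = W\<^sub>t\<close>, and its exponent is a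
  combination of \<open>x\<^sup>2\<close>, \<open>x \<bullet> v\<close> and \<open>v\<^sup>2\<close>, so \<open>W\<^sub>s(v') W\<^sub>s(v\<^sub>*') = W\<^sub>s(v) W\<^sub>s(v\<^sub>*)\<close> by momentum
  and energy conservation (\<open>moving_Maxwellian_collision\<close>). On \<open>[0, T]\<close> a multiple of it
  dominates the given Maxwellian bound, and it is dominated by a Maxwellian weight with a smaller
  exponent.

  If \<open>f\<close> and \<open>T\<^sub>y f\<close> are bounded by \<open>B W\<^sub>s\<close> and \<open>D(s)\<close> by \<open>d W\<^sub>s\<close>, bilinearity and the
  invariance of \<open>W\<^sub>s\<close> bound \<open>J(T\<^sub>y f) - J(f)\<close> by \<open>4 B d W\<^sub>s(v)\<close> times the collision frequency of
  \<open>W\<^sub>s\<close>, which is finite uniformly in \<open>v\<close> because \<open>|v|\<close> to the power \<open>- lam\<close> is locally integrable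
  (\<open>collision_op_Lipschitz\<close>, \<open>riesz_potential_gaussian_bounded\<close>).

  All bounds hold only almost everywhere, which needs two supplements. The collision integral
  evaluates \<open>f\<close> at post-collisional velocities, so null sets must be followed through the
  collision map, a linear involution (\<open>AE_collision\<close>). The time integral is a limit of Riemann sums in
  \<open>L\<^sup>1\<close>, and pointwise bounds pass to such limits (\<open>Riemann_integral_translation_bound\<close>). Gronwall's
  lemma itself takes the form of an iteration: with \<open>L\<close> twice the Lipschitz constant, a bound
  \<open>c exp (L s) W\<^sub>s\<close> for all \<open>s\<close> improves to the same bound with \<open>n + c / 2\<close> in place of \<open>c\<close>, where \<open>n\<close>
  bounds the initial difference, and hence holds with \<open>2 n\<close>.
\<close>

section \<open>Null sets under transport and collisions\<close>

text \<open>
  A property valid almost everywhere may be evaluated along \<open>\<phi>\<close>: the exceptional points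
  form a subset of \<open>\<psi> ` N\<close> for a null set \<open>N\<close>, and differentiable maps of a Euclidean space into
  itself preserve null sets. In this form no Jacobian has to be computed.
\<close>
lemma AE_lborel_compose_invertible:
  fixes \<phi> \<psi> :: "'a::euclidean_space \<Rightarrow> 'a"
  assumes "AE z in lborel. P z" and diff: "\<psi> differentiable_on UNIV"
    and inv: "\<And>z. \<psi> (\<phi> z) = z"
  shows "AE z in lborel. P (\<phi> z)"
proof -
  obtain N where N: "\<And>z. z \<notin> N \<Longrightarrow> P z" "N \<in> null_sets lborel"
    using AE_E3[OF assms(1)] by auto
  have "negligible N"
    using N(2) by (simp add: negligible_iff_null_sets null_sets_completionI)
  then have "negligible (\<psi> ` N)"
    by (rule negligible_differentiable_image_negligible[OF order_refl])
       (use diff in \<open>auto intro: differentiable_on_subset\<close>)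
  then have "AE z in lebesgue. z \<notin> \<psi> ` N"
    by (simp add: negligible_iff_null_sets AE_not_in)
  then have "AE z in lborel. z \<notin> \<psi> ` N"
    by (simp add: AE_completion_iff)
  then show ?thesis
  proof eventually_elim
    case (elim z)
    have "\<phi> z \<notin> N"
      using elim inv[of z] by (metis imageI)
    then show ?case by (rule N(1))
  qed
qed

lemma AE_translate:
  assumes "AE z in lborel. P (z :: phase)"
  shows "AE (x, v) in lborel. P (x + y, v)"
proof -
  have "AE z in lborel. P ((\<lambda>(x, v). (x + y, v)) z)"
    by (rule AE_lborel_compose_invertible[OF assms, where \<psi> = "\<lambda>z. z + (- y, 0)"])
       (auto intro!: derivative_intros simp: differentiable_on_def)
  then show ?thesis by (simp add: case_prod_beta)
qed

lemma AE_free_flow: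
  assumes "AE z in lborel. P (z :: phase)"
  shows "AE (x, v) in lborel. P (x - t *\<^sub>R v, v)"
proof -
  have "linear (\<lambda>z::phase. (fst z + t *\<^sub>R snd z, snd z))"
    by (rule linearI) (auto simp: algebra_simps)
  then have "AE z in lborel. P ((\<lambda>(x, v). (x - t *\<^sub>R v, v)) z)"
    by (intro AE_lborel_compose_invertible[OF assms,
          where \<psi> = "\<lambda>z::phase. (fst z + t *\<^sub>R snd z, snd z)"])
       (auto intro!: linear_imp_differentiable_on)
  then show ?thesis by (simp add: case_prod_beta)
qed

text \<open>
  The collision reverses the component of \<open>v - vs\<close> along \<open>w\<close>, so colliding twice restores the
  velocities. This makes the collision map its own inverse, hence compatible with null sets.
\<close>
lemma post_v_involution:
  assumes "norm w = 1"
  shows "post_v (post_v v vs w) (post_vs v vs w) w = v"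
    and "post_vs (post_v v vs w) (post_vs v vs w) w = vs"
proof -
  have "w \<bullet> w = 1" using assms by (simp add: norm_eq_1)
  then have "(post_v v vs w - post_vs v vs w) \<bullet> w = - ((v - vs) \<bullet> w)"
    unfolding post_v_def post_vs_def inner_diff_left inner_add_left inner_scaleR_left by simp
  then show "post_v (post_v v vs w) (post_vs v vs w) w = v"
    "post_vs (post_v v vs w) (post_vs v vs w) w = vs"
    unfolding post_v_def[of "post_v v vs w"] post_vs_def[of "post_v v vs w"]
    by (simp_all add: post_v_def post_vs_def)
qed

lemma post_v_add:
  "post_v (v + v') (vs + vs') w = post_v v vs w + post_v v' vs' w"
  "post_vs (v + v') (vs + vs') w = post_vs v vs w + post_vs v' vs' w"
  by (simp_all add: post_v_def post_vs_def inner_diff_left inner_add_left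
      scaleR_left_distrib scaleR_left_diff_distrib)

lemma post_v_scaleR:
  "post_v (c *\<^sub>R v) (c *\<^sub>R vs) w = c *\<^sub>R post_v v vs w"
  "post_vs (c *\<^sub>R v) (c *\<^sub>R vs) w = c *\<^sub>R post_vs v vs w"
  by (simp_all add: post_v_def post_vs_def inner_diff_left scaleR_right_distrib
      scaleR_right_diff_distrib flip: right_diff_distrib)

lemma post_v_involution_swapped:
  assumes "norm w = 1"
  shows "post_vs (post_vs v vs w) (post_v v vs w) w = v"
    and "post_v (post_vs v vs w) (post_v v vs w) w = vs"
proof -
  have swap: "post_v p q w = post_vs q p w" for p q
    by (simp add: post_v_def post_vs_def algebra_simps)
  show "post_vs (post_vs v vs w) (post_v v vs w) w = v"
    "post_v (post_vs v vs w) (post_v v vs w) w = vs"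
    using post_v_involution[OF assms, of v vs] by (metis swap)+
qed

lemma borel_measurable_post_v [measurable (raw)]:
  assumes [measurable]: "f \<in> borel_measurable M" "g \<in> borel_measurable M" "h \<in> borel_measurable M"
  shows "(\<lambda>q. post_v (f q) (g q) (h q)) \<in> borel_measurable M"
    and "(\<lambda>q. post_vs (f q) (g q) (h q)) \<in> borel_measurable M"
  by (simp_all add: post_v_def post_vs_def)

interpretation sphere_measure: finite_measure "sphere_measure :: vec3 measure"
  by standard (simp add: emeasure_sphere_measure_UNIV)

lemma AE_lborel_prod:
  fixes P :: "'a::euclidean_space \<times> 'b::euclidean_space \<Rightarrow> bool"
  shows "(AE q in lborel \<Otimes>\<^sub>M lborel. P q) \<longleftrightarrow> (AE q in lborel. P q)"
  by (subst lborel_prod) (rule refl)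

text \<open>
  For a fixed unit vector, \<open>(x, v, vs) \<mapsto> (x, v', vs')\<close> is an invertible linear map of \<open>\<real>\<^sup>9\<close>. Keeping
  \<open>v\<close> fixed would not do: \<open>v'\<close> then moves along a line only, and a null set of velocities may
  contain that line. This is why \<open>v\<close> and \<open>vs\<close> have to vary together.
\<close>
lemma AE_collision_unit:
  fixes N :: "phase set"
  assumes N: "N \<in> null_sets lborel" and w: "norm w = 1"
  shows "AE ((x, v), vs) in lborel.
    (x, vs) \<notin> N \<and> (x, post_v v vs w) \<notin> N \<and> (x, post_vs v vs w) \<notin> N"
proof -
  have [measurable]: "N \<in> sets borel" using N by (auto simp: null_sets_def)
  have "AE z in lborel. z \<notin> N" using N by (rule AE_not_in)
  then have "AE z in lborel. AE vs in (lborel :: vec3 measure). z \<notin> N"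
    by eventually_elim simp
  then have "AE q in lborel \<Otimes>\<^sub>M (lborel :: vec3 measure). fst q \<notin> N"
  proof (subst lborel_pair.AE_pair_iff[symmetric])
    show "{q \<in> space (lborel \<Otimes>\<^sub>M (lborel :: vec3 measure)). fst q \<notin> N} \<in> sets (lborel \<Otimes>\<^sub>M lborel)"
      by measurable
  qed
  then have base: "AE q in (lborel :: (phase \<times> vec3) measure). fst q \<notin> N"
    by (simp only: AE_lborel_prod)
  let ?s = "\<lambda>q::phase \<times> vec3. ((fst (fst q), snd q), snd (fst q))"
  let ?c = "\<lambda>q::phase \<times> vec3. ((fst (fst q), post_v (snd (fst q)) (snd q) w),
                                  post_vs (snd (fst q)) (snd q) w)"
  let ?d = "\<lambda>q::phase \<times> vec3. ((fst (fst q), post_vs (snd (fst q)) (snd q) w),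
                                  post_v (snd (fst q)) (snd q) w)"
  have "linear ?s" by (rule linearI) auto
  then have 1: "AE q in lborel. fst (?s q) \<notin> N"
    by (intro AE_lborel_compose_invertible[OF base, where \<phi> = ?s and \<psi> = ?s])
       (auto intro: linear_imp_differentiable_on)
  have "linear ?c" by (rule linearI) (auto simp: post_v_add post_v_scaleR)
  then have 2: "AE q in lborel. fst (?c q) \<notin> N"
    by (intro AE_lborel_compose_invertible[OF base, where \<phi> = ?c and \<psi> = ?c])
       (auto intro: linear_imp_differentiable_on simp: post_v_involution[OF w])
  have "linear ?d" by (rule linearI) (auto simp: post_v_add post_v_scaleR)
  then have 3: "AE q in lborel. fst (?d q) \<notin> N"
    by (intro AE_lborel_compose_invertible[OF base, where \<phi> = ?d and \<psi> = ?d])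
       (auto intro: linear_imp_differentiable_on simp: post_v_involution[OF w]
         post_v_involution_swapped[OF w])
  from 1 2 3 show ?thesis by eventually_elim (auto simp: case_prod_beta)
qed

text \<open>
  The collision integral samples its argument at \<open>vs\<close>, \<open>v'\<close> and \<open>vs'\<close>, where the argument is known
  only up to null sets of phase space. By Fubini, a property valid almost everywhere still holds
  at almost all points that the integral sees, for almost every \<open>(x, v)\<close>.
\<close>
lemma AE_collision:
  assumes "AE z in lborel. P (z :: phase)"
  shows "AE (x, v) in lborel. AE (vs, w) in lborel \<Otimes>\<^sub>M sphere_measure.
    norm w = 1 \<and> P (x, vs) \<and> P (x, post_v v vs w) \<and> P (x, post_vs v vs w)"
proof -
  obtain N where NP: "\<And>z. z \<notin> N \<Longrightarrow> P z" and N: "N \<in> null_sets lborel"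
    using AE_E3[OF assms] by auto
  have [measurable]: "N \<in> sets borel" using N by (auto simp: null_sets_def)
  define Q where "Q = (\<lambda>w (q :: phase \<times> vec3). norm w = 1 \<and> (fst (fst q), snd q) \<notin> N \<and>
      (fst (fst q), post_v (snd (fst q)) (snd q) w) \<notin> N \<and>
      (fst (fst q), post_vs (snd (fst q)) (snd q) w) \<notin> N)"
  interpret wq: pair_sigma_finite "sphere_measure :: vec3 measure" "lborel :: (phase \<times> vec3) measure" ..
  interpret vw: pair_sigma_finite "lborel :: vec3 measure" "sphere_measure :: vec3 measure" ..
  have Q_meas: "{p. Q (f p) (g p)} \<in> sets M"
    if [measurable]: "f \<in> borel_measurable M" "g \<in> borel_measurable M" and "space M = UNIV"
    for f g and M :: "'z measure"
  proof -
    have [measurable]: "(\<lambda>q. fst (g q)) \<in> borel_measurable M" "(\<lambda>q. snd (g q)) \<in> borel_measurable M"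
      by (auto intro!: borel_measurable_continuous_on[OF _ that(2)] continuous_intros)
    have [measurable]: "(\<lambda>q. fst (fst (g q))) \<in> borel_measurable M"
        "(\<lambda>q. snd (fst (g q))) \<in> borel_measurable M"
      by (auto intro!: borel_measurable_continuous_on[where f = "\<lambda>p. fst p"]
          borel_measurable_continuous_on[where f = "\<lambda>p. snd p"] continuous_intros)
    have N': "{p \<in> space M. h p \<notin> N} \<in> sets M" if [measurable]: "h \<in> borel_measurable M" for h
      by measurable
    have "{p \<in> space M. norm (f p) = 1} \<in> sets M" by measurable
    then have "{p \<in> space M. Q (f p) (g p)} \<in> sets M"
      unfolding Q_def by (intro sets.sets_Collect_conj N' borel_measurable_Pair) measurable
    then show ?thesis using that by simp
  qed
  have "AE w in sphere_measure. AE q in lborel. Q w q"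
    using AE_sphere_measure_norm
  proof eventually_elim
    case (elim w)
    show ?case using AE_collision_unit[OF N elim]
      by eventually_elim (auto simp: Q_def elim case_prod_beta)
  qed
  \<comment> \<open>The order of the variables is exchanged so that \<open>(x, v)\<close> comes first and \<open>w\<close> last.\<close>
  then have "AE q in lborel. AE w in sphere_measure. Q w q"
    by (subst (asm) wq.AE_commute)
       (auto intro!: Q_meas simp: space_pair_measure)
  then have "AE q in lborel \<Otimes>\<^sub>M lborel. AE w in sphere_measure. Q w q"
    by (simp only: AE_lborel_prod)
  then have "AE z in lborel. AE vs in lborel. AE w in sphere_measure. Q w (z, vs)"
    by (rule lborel_pair.AE_pair)
  then show ?thesis
  proof eventually_elim
    case (elim z)
    have "AE p in lborel \<Otimes>\<^sub>M sphere_measure. Q (snd p) (z, fst p)"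
      using elim
      by (subst vw.AE_pair_iff[symmetric]) (auto intro!: Q_meas simp: space_pair_measure)
    then have "AE (vs, w) in lborel \<Otimes>\<^sub>M sphere_measure.
      norm w = 1 \<and> P (fst z, vs) \<and> P (fst z, post_v (snd z) vs w) \<and> P (fst z, post_vs (snd z) vs w)"
      by eventually_elim (auto simp: Q_def intro!: NP)
    then show ?case by (simp add: case_prod_beta)
  qed
qed

section \<open>Maxwellian weights\<close>

lemma Maxw_norm_leI:
  assumes "g \<in> borel_measurable borel" and "AE z in lborel. \<bar>g z\<bar> \<le> c * gauss_weight \<tau> \<tau> z"
  shows "Maxw_norm \<tau> g \<le> ereal c"
proof -
  have [measurable]: "gauss_weight \<tau> \<tau> \<in> borel_measurable borel"
    unfolding gauss_weight_def case_prod_beta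
    by (intro borel_measurable_continuous_onI continuous_intros)
  note assms(1)[measurable]
  show ?thesis
    unfolding Maxw_norm_def Linf_norm_def
  proof (rule esssup_I)
    show "(\<lambda>z. ereal \<bar>inverse (gauss_weight \<tau> \<tau> z) * g z\<bar>) \<in> borel_measurable lborel"
      by measurable
    show "AE z in lborel. ereal \<bar>inverse (gauss_weight \<tau> \<tau> z) * g z\<bar> \<le> ereal c"
      using assms(2)
      by eventually_elim
         (auto simp: gauss_weight_def case_prod_beta abs_mult field_simps)
  qed
qed

lemma Maxw_norm_leD:
  assumes "Maxw_norm \<tau> g \<le> ereal c"
  shows "AE z in lborel. \<bar>g z\<bar> \<le> c * gauss_weight \<tau> \<tau> z"
proof -
  have "AE z in lborel. ereal \<bar>inverse (gauss_weight \<tau> \<tau> z) * g z\<bar> \<le> Maxw_norm \<tau> g"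
    unfolding Maxw_norm_def Linf_norm_def by (rule esssup_AE)
  then show ?thesis
  proof eventually_elim
    case (elim z)
    then have "\<bar>inverse (gauss_weight \<tau> \<tau> z) * g z\<bar> \<le> c"
      using assms by (metis ereal_less_eq(3) order_trans)
    then show ?case
      by (auto simp: gauss_weight_def case_prod_beta abs_mult field_simps)
  qed
qed

lemma gauss_weight_antimono:
  assumes "\<tau> \<le> \<tau>'"
  shows "gauss_weight \<tau>' \<tau>' z \<le> gauss_weight \<tau> \<tau> z"
proof -
  have "\<tau> * ((norm (fst z))\<^sup>2 + (norm (snd z))\<^sup>2) \<le> \<tau>' * ((norm (fst z))\<^sup>2 + (norm (snd z))\<^sup>2)"
    using assms by (intro mult_right_mono) auto
  then show ?thesis by (simp add: gauss_weight_def case_prod_beta distrib_left)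
qed

text \<open>
  The Maxwellian of \<open>x\<^sup>2 + v\<^sup>2\<close> carried along by free transport for time \<open>s\<close>. It serves as the
  time-dependent weight of all the estimates.
\<close>
definition moving_Maxwellian :: "real \<Rightarrow> real \<Rightarrow> phase \<Rightarrow> real" where
  "moving_Maxwellian \<beta> s = free_flow s (gauss_weight \<beta> \<beta>)"

lemma moving_Maxwellian_eq:
  "moving_Maxwellian \<beta> s (x, v) = exp (- \<beta> * ((norm (x - s *\<^sub>R v))\<^sup>2 + (norm v)\<^sup>2))"
  by (simp add: moving_Maxwellian_def free_flow_def gauss_weight_def algebra_simps)

lemma moving_Maxwellian_flow:
  "moving_Maxwellian \<beta> s (x - (t - s) *\<^sub>R v, v) = moving_Maxwellian \<beta> t (x, v)"
  by (simp add: moving_Maxwellian_eq algebra_simps)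

lemma moving_Maxwellian_nonneg: "0 \<le> moving_Maxwellian \<beta> s z"
  by (cases z) (simp add: moving_Maxwellian_eq)

lemma moving_Maxwellian_measurable [measurable]:
  "moving_Maxwellian \<beta> s \<in> borel_measurable borel"
  unfolding moving_Maxwellian_def free_flow_def gauss_weight_def case_prod_beta prod.case
  by (intro borel_measurable_continuous_onI continuous_intros)

text \<open>
  Momentum and energy conservation give \<open>v' + vs' = v + vs\<close> and
  \<open>v'\<^sup>2 + vs'\<^sup>2 = v\<^sup>2 + vs\<^sup>2\<close>; the exponent is a combination of \<open>x\<^sup>2\<close>, \<open>x \<bullet> v\<close> and \<open>v\<^sup>2\<close>, and
  its sum over the two partners therefore survives the collision.
\<close>
lemma moving_Maxwellian_collision:
  assumes "norm w = 1"
  shows "moving_Maxwellian \<beta> s (x, post_v v vs w) * moving_Maxwellian \<beta> s (x, post_vs v vs w)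
       = moving_Maxwellian \<beta> s (x, v) * moving_Maxwellian \<beta> s (x, vs)"
proof -
  let ?k = "(v - vs) \<bullet> w"
  have mom: "post_v v vs w + post_vs v vs w = v + vs"
    by (simp add: post_v_def post_vs_def)
  have sq: "(norm (p + c *\<^sub>R q))\<^sup>2 = (norm p)\<^sup>2 + 2 * c * (p \<bullet> q) + c\<^sup>2 * (norm q)\<^sup>2"
    for p q :: vec3 and c :: real
    unfolding power2_norm_eq_inner inner_add_left inner_add_right inner_scaleR_left
      inner_scaleR_right inner_commute[of q p] by algebra
  have post: "post_v v vs w = v + (- ?k) *\<^sub>R w" "post_vs v vs w = vs + ?k *\<^sub>R w"
    by (simp_all add: post_v_def post_vs_def)
  have k: "v \<bullet> w - vs \<bullet> w = ?k" by (simp add: inner_diff_left)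
  have en: "(norm (post_v v vs w))\<^sup>2 + (norm (post_vs v vs w))\<^sup>2 = (norm v)\<^sup>2 + (norm vs)\<^sup>2"
  proof -
    have "n + 2 * - d * a + (- d)\<^sup>2 * 1\<^sup>2 + (n' + 2 * d * a' + d\<^sup>2 * 1\<^sup>2) = n + n'"
      if "a - a' = d" for n n' d a a' :: real
      using that by (auto simp: power2_eq_square algebra_simps)
    from this[OF k] show ?thesis unfolding post sq assms .
  qed
  \<comment> \<open>The sum of the transported squares involves only momentum and energy, which are conserved.\<close>
  have exp: "(norm (x - s *\<^sub>R p))\<^sup>2 + (norm (x - s *\<^sub>R q))\<^sup>2
      = 2 * (norm x)\<^sup>2 - 2 * s * (x \<bullet> (p + q)) + s\<^sup>2 * ((norm p)\<^sup>2 + (norm q)\<^sup>2)" for p q :: vec3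
    using sq[of x "- s" p] sq[of x "- s" q] by (simp add: inner_add_right algebra_simps)
  have "(norm (x - s *\<^sub>R post_v v vs w))\<^sup>2 + (norm (x - s *\<^sub>R post_vs v vs w))\<^sup>2
      = (norm (x - s *\<^sub>R v))\<^sup>2 + (norm (x - s *\<^sub>R vs))\<^sup>2"
    unfolding exp mom en ..
  with en have "((norm (x - s *\<^sub>R post_v v vs w))\<^sup>2 + (norm (post_v v vs w))\<^sup>2)
      + ((norm (x - s *\<^sub>R post_vs v vs w))\<^sup>2 + (norm (post_vs v vs w))\<^sup>2)
    = ((norm (x - s *\<^sub>R v))\<^sup>2 + (norm v)\<^sup>2) + ((norm (x - s *\<^sub>R vs))\<^sup>2 + (norm vs)\<^sup>2)"
    by linarith
  then show ?thesis
    by (simp only: moving_Maxwellian_eq exp_add[symmetric] distrib_left[symmetric])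
qed

lemma norm_add_power2_le:
  fixes a b :: "'a::real_inner"
  shows "(norm (a + b))\<^sup>2 \<le> 2 * (norm a)\<^sup>2 + 2 * (norm b)\<^sup>2"
proof -
  have "0 \<le> (norm (a - b))\<^sup>2" by simp
  then show ?thesis
    by (simp add: power2_norm_eq_inner inner_add_left inner_add_right inner_diff_left
        inner_diff_right inner_commute)
qed

text \<open>
  Passage from the fixed weight of the a priori bound to the moving one. The shift costs a factor 2
  in the exponent, by \<open>x\<^sup>2 \<le> 2 (x + y)\<^sup>2 + 2\<close>, and \<open>exp \<tau>\<close> in front; the transport costs a factor
  \<open>2 (1 + T\<^sup>2)\<close>, by \<open>(x - s v)\<^sup>2 \<le> 2 x\<^sup>2 + 2 T\<^sup>2 v\<^sup>2\<close>. The choice of \<open>\<beta>\<close> pays for both.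
\<close>
lemma gauss_weight_translate_le:
  assumes "0 < \<tau>" "norm y \<le> 1" "\<beta> = \<tau> / (4 * (1 + T\<^sup>2))" "0 \<le> s" "s \<le> T"
  shows "gauss_weight \<tau> \<tau> (x + y, v) \<le> exp \<tau> * moving_Maxwellian \<beta> s (x, v)"
proof -
  let ?X = "(norm x)\<^sup>2" and ?V = "(norm v)\<^sup>2"
  have \<beta>: "0 \<le> \<beta>" using assms by simp
  have 4: "4 * \<beta> * (1 + T\<^sup>2) = \<tau>"
    using assms(3) sum_power2_gt_zero_iff[of 1 T] by (simp add: field_simps)
  have s: "s\<^sup>2 \<le> T\<^sup>2" using assms by (simp add: power_mono)
  have y: "(norm y)\<^sup>2 \<le> 1" using assms by (simp add: power_le_one)
  have "(norm (x + y + (- y)))\<^sup>2 \<le> 2 * (norm (x + y))\<^sup>2 + 2 * (norm (- y))\<^sup>2"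
    by (rule norm_add_power2_le)
  then have 1: "?X \<le> 2 * (norm (x + y))\<^sup>2 + 2" using y by simp
  have "(norm (x + - (s *\<^sub>R v)))\<^sup>2 \<le> 2 * ?X + 2 * (norm (- (s *\<^sub>R v)))\<^sup>2"
    by (rule norm_add_power2_le)
  then have "(norm (x - s *\<^sub>R v))\<^sup>2 \<le> 2 * ?X + 2 * (s\<^sup>2 * ?V)"
    by (simp add: power_mult_distrib)
  also have "\<dots> \<le> 2 * ?X + 2 * (T\<^sup>2 * ?V)"
    using s by (simp add: mult_right_mono)
  finally have "\<beta> * ((norm (x - s *\<^sub>R v))\<^sup>2 + ?V) \<le> \<beta> * (2 * ?X + 2 * (T\<^sup>2 * ?V) + ?V)"
    using \<beta> by (intro mult_left_mono) auto
  also have "\<dots> \<le> \<beta> * (2 * (1 + T\<^sup>2) * ?X + 4 * (1 + T\<^sup>2) * ?V)"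
    using \<beta> by (intro mult_left_mono) (auto simp: algebra_simps)
  also have "\<dots> = \<tau> / 2 * ?X + \<tau> * ?V"
    unfolding 4[symmetric] by (simp add: algebra_simps)
  also have "\<dots> \<le> \<tau> / 2 * (2 * (norm (x + y))\<^sup>2 + 2) + \<tau> * ?V"
    using 1 assms(1) by simp
  finally show ?thesis
    by (simp add: gauss_weight_def moving_Maxwellian_eq flip: exp_add) (simp add: field_simps)
qed

lemma gauss_weight_le_moving_Maxwellian_0:
  assumes "0 < \<tau>" "\<beta> = \<tau> / (4 * (1 + T\<^sup>2))"
  shows "gauss_weight \<tau> \<tau> z \<le> moving_Maxwellian \<beta> 0 z"
proof -
  have "\<beta> \<le> \<tau>"
    unfolding assms(2) using assms(1) by (simp add: divide_le_eq add_pos_nonneg)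
  moreover have "moving_Maxwellian \<beta> 0 = gauss_weight \<beta> \<beta>"
    by (simp add: moving_Maxwellian_def free_flow_def)
  ultimately show ?thesis by (simp add: gauss_weight_antimono)
qed

text \<open>
  The way back from the moving weight to a fixed one, by \<open>x\<^sup>2 \<le> 2 (x - t v)\<^sup>2 + 2 T\<^sup>2 v\<^sup>2\<close>. This is
  where the exponent of the conclusion is lost, and why it depends on \<open>T\<close>.
\<close>
lemma moving_Maxwellian_le_gauss_weight:
  assumes "0 < \<beta>" "\<tau> = \<beta> / (2 * (1 + T\<^sup>2))" "0 \<le> t" "t \<le> T"
  shows "moving_Maxwellian \<beta> t z \<le> gauss_weight \<tau> \<tau> z"
proof -
  obtain x v where z: "z = (x, v)" by (cases z)
  let ?X = "(norm (x - t *\<^sub>R v))\<^sup>2" and ?V = "(norm v)\<^sup>2"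
  have \<tau>: "0 \<le> \<tau>" using assms by simp
  have 2: "2 * \<tau> * (1 + T\<^sup>2) = \<beta>"
    using assms(2) sum_power2_gt_zero_iff[of 1 T] by (simp add: field_simps)
  have s: "t\<^sup>2 \<le> T\<^sup>2" using assms by (simp add: power_mono)
  have "(norm ((x - t *\<^sub>R v) + t *\<^sub>R v))\<^sup>2 \<le> 2 * ?X + 2 * (norm (t *\<^sub>R v))\<^sup>2"
    by (rule norm_add_power2_le)
  then have "(norm x)\<^sup>2 \<le> 2 * ?X + 2 * (t\<^sup>2 * ?V)"
    by (simp add: power_mult_distrib)
  also have "\<dots> \<le> 2 * ?X + 2 * (T\<^sup>2 * ?V)"
    using s by (simp add: mult_right_mono)
  finally have "\<tau> * ((norm x)\<^sup>2 + ?V) \<le> \<tau> * (2 * ?X + 2 * (T\<^sup>2 * ?V) + ?V)"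
    using \<tau> by (intro mult_left_mono) auto
  also have "\<dots> \<le> \<tau> * (2 * (1 + T\<^sup>2) * ?X + 2 * (1 + T\<^sup>2) * ?V)"
    using \<tau> by (intro mult_left_mono) (auto simp: algebra_simps)
  also have "\<dots> = \<beta> * (?X + ?V)"
    unfolding 2[symmetric] by (simp add: algebra_simps)
  finally show ?thesis
    by (simp add: z gauss_weight_def moving_Maxwellian_eq) (simp add: algebra_simps)
qed

section \<open>The collision frequency of a Maxwellian\<close>

lemma nn_integral_lborel_translate:
  fixes c :: "'a::euclidean_space"
  assumes [measurable]: "f \<in> borel_measurable borel"
  shows "(\<integral>\<^sup>+x. f (x + c) \<partial>lborel) = (\<integral>\<^sup>+x. f x \<partial>lborel)"
proof -
  have "(\<integral>\<^sup>+x. f x \<partial>lborel) = (\<integral>\<^sup>+x. f x \<partial>distr lborel borel ((+) c))"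
    by (simp add: lborel_distr_plus)
  also have "\<dots> = (\<integral>\<^sup>+x. f (x + c) \<partial>lborel)"
    by (subst nn_integral_distr) (auto simp: add.commute)
  finally show ?thesis ..
qed

lemma emeasure_ball_vec3:
  assumes "0 \<le> r"
  shows "emeasure lborel (ball (0::vec3) r) = ennreal (4 / 3 * pi * r ^ 3)"
  using assms by (simp add: emeasure_ball eval_unit_ball_vol)

text \<open>
  A function dominated by \<open>c k\<close> on the part of the ball of radius \<open>r k\<close> that is assigned to \<open>k\<close> has
  integral at most the sum of the volumes of the cylinders of height \<open>c k\<close> over these balls. Both a
  singularity at the origin and decay at infinity are handled in this way.
\<close>
lemma nn_integral_layers_finite:
  fixes c r :: "nat \<Rightarrow> real"
  assumes c: "\<And>k. 0 \<le> c k" and r: "\<And>k. 0 \<le> r k"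
    and sum: "summable (\<lambda>k. c k * (r k) ^ 3)"
    and le: "AE u in lborel. f u = 0 \<or> (\<exists>k. norm (u :: vec3) < r k \<and> f u \<le> ennreal (c k))"
  shows "(\<integral>\<^sup>+u. f u \<partial>lborel) < \<infinity>"
proof -
  have "(\<integral>\<^sup>+u. f u \<partial>lborel) \<le> (\<integral>\<^sup>+(u::vec3). (\<Sum>k. ennreal (c k) * indicator (ball 0 (r k)) u) \<partial>lborel)"
    using le
  proof (intro nn_integral_mono_AE, eventually_elim)
    case (elim u)
    then consider "f u = 0" | k where "norm u < r k" "f u \<le> ennreal (c k)" by auto
    then show ?case
    proof cases
      case (2 k)
      have "f u \<le> (\<Sum>j\<in>{k}. ennreal (c j) * indicator (ball 0 (r j)) u)"
        using 2 by simp
      also have "\<dots> \<le> (\<Sum>j. ennreal (c j) * indicator (ball 0 (r j)) u)"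
        by (rule sum_le_suminf) auto
      finally show ?thesis .
    qed simp
  qed
  also have "\<dots> = (\<Sum>k. \<integral>\<^sup>+(u::vec3). ennreal (c k) * indicator (ball 0 (r k)) u \<partial>lborel)"
    by (intro nn_integral_suminf borel_measurable_times_ennreal borel_measurable_const
        borel_measurable_indicator) simp
  also have "\<dots> = (\<Sum>k. ennreal (4 / 3 * pi * (c k * (r k) ^ 3)))"
    by (intro suminf_cong)
       (simp add: nn_integral_cmult_indicator emeasure_ball_vec3 r c flip: ennreal_mult)
  also have "\<dots> = ennreal (\<Sum>k. 4 / 3 * pi * (c k * (r k) ^ 3))"
    by (intro suminf_ennreal2 summable_mult sum) (simp add: c r)
  finally show ?thesis by (simp add: le_less_trans)
qed

lemma nn_integral_gaussian_finite:
  assumes "0 < \<beta>"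
  shows "(\<integral>\<^sup>+u. ennreal (exp (- \<beta> * (norm (u :: vec3))\<^sup>2)) \<partial>lborel) < \<infinity>"
proof (rule nn_integral_layers_finite[where c = "\<lambda>k. exp (- \<beta> * (real k)\<^sup>2)" and r = "\<lambda>k. real k + 1"])
  have "(\<lambda>k. exp (- \<beta> * (real k)\<^sup>2) * (real k + 1) ^ 3) \<in> O(\<lambda>k. 1 / (real k)\<^sup>2)"
    using assms by real_asymp
  then show "summable (\<lambda>k. exp (- \<beta> * (real k)\<^sup>2) * (real k + 1) ^ 3)"
    by (rule summable_comparison_test_bigo[rotated])
       (use inverse_power_summable[of 2, where 'a = real] in \<open>simp add: field_simps\<close>)
  show "AE u in lborel. ennreal (exp (- \<beta> * (norm u)\<^sup>2)) = 0 \<or> (\<exists>k. norm (u :: vec3) < real k + 1 \<and>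
      ennreal (exp (- \<beta> * (norm u)\<^sup>2)) \<le> ennreal (exp (- \<beta> * (real k)\<^sup>2)))"
  proof (intro always_eventually allI disjI2)
    fix u :: vec3
    let ?k = "nat \<lfloor>norm u\<rfloor>"
    have "real ?k \<le> norm u" "norm u < real ?k + 1" by auto
    then show "\<exists>k. norm u < real k + 1 \<and>
        ennreal (exp (- \<beta> * (norm u)\<^sup>2)) \<le> ennreal (exp (- \<beta> * (real k)\<^sup>2))"
      using assms by (intro exI[of _ ?k]) (auto intro!: power_mono)
  qed
qed auto

text \<open>
  On the dyadic shell \<open>2\<^sup>-\<^sup>k\<^sup>-\<^sup>1 \<le> |u| < 2\<^sup>-\<^sup>k\<close> the integrand is at most \<open>2 powr (lam * (k + 1))\<close>, against
  a volume of order \<open>8\<^sup>-\<^sup>k\<close>: a geometric series with ratio \<open>2 powr lam / 8\<close>.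
\<close>
lemma nn_integral_singularity_finite:
  assumes "0 \<le> lam" "lam < 3"
  shows "(\<integral>\<^sup>+u. ennreal (norm (u :: vec3) powr (- lam)) * indicator (ball 0 1) u \<partial>lborel) < \<infinity>"
proof (rule nn_integral_layers_finite[where c = "\<lambda>k. (2 powr lam) ^ Suc k" and r = "\<lambda>k. (1 / 2) ^ k"])
  let ?q = "2 powr lam / 8"
  have "2 powr lam < 2 powr 3" using assms by (intro powr_less_mono) auto
  then have "summable (\<lambda>k. 2 powr lam * ?q ^ k)"
    by (intro summable_mult summable_geometric) simp
  moreover have "2 powr lam * ?q ^ k = (2 powr lam) ^ Suc k * ((1 / 2) ^ k) ^ 3" for k
    by (simp add: power_divide power_mult[symmetric] mult.commute[of k] flip: power_mult)
       (simp add: power_mult)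
  ultimately show "summable (\<lambda>k. (2 powr lam) ^ Suc k * ((1 / 2) ^ k) ^ 3)" by simp
  have "AE u in lborel. (u :: vec3) \<noteq> 0" by (rule AE_lborel_singleton)
  then show "AE u in lborel. ennreal (norm (u :: vec3) powr (- lam)) * indicator (ball 0 1) u = 0 \<or>
      (\<exists>k. norm u < (1 / 2) ^ k \<and>
        ennreal (norm u powr (- lam)) * indicator (ball 0 1) u \<le> ennreal ((2 powr lam) ^ Suc k))"
  proof eventually_elim
    case (elim u)
    show ?case
    proof (cases "norm u < 1")
      case True
      have ex: "\<exists>k. (1 / 2) ^ k \<le> norm u"
        using real_arch_pow_inv[of "norm u" "1 / 2"] elim by (auto intro: less_imp_le)
      \<comment> \<open>The shell containing \<open>u\<close> has the number \<open>k\<close> with \<open>m = k + 1\<close>; \<open>m\<close> is positive as \<open>|u| < 1\<close>.\<close>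
      define m where "m = (LEAST k. (1 / 2) ^ k \<le> norm u)"
      have m: "(1 / 2) ^ m \<le> norm u" unfolding m_def using ex by (rule LeastI_ex)
      then have "m \<noteq> 0" using True by (cases m) auto
      then obtain k where k: "m = Suc k" by (cases m) auto
      have "\<not> (1 / 2) ^ k \<le> norm u" by (rule not_less_Least) (simp add: k flip: m_def)
      moreover have "norm u powr (- lam) \<le> (2 powr lam) ^ Suc k"
      proof -
        have "norm u powr (- lam) \<le> ((1 / 2) ^ m) powr (- lam)"
          using m assms by (intro powr_mono2') auto
        also have "\<dots> = (2 powr lam) ^ m"
          by (simp add: powr_realpow[symmetric] powr_powr powr_minus powr_divide field_simps
              flip: powr_realpow)
        finally show ?thesis by (simp add: k)
      qed
      ultimately show ?thesis using True by (intro disjI2 exI[of _ k]) (auto simp: ennreal_leI)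
    next
      case False
      then show ?thesis by (simp add: indicator_def)
    qed
  qed
qed auto

text \<open>
  The collision frequency of a Maxwellian is bounded uniformly in \<open>v\<close>: near \<open>vs = v\<close> the
  Gaussian is at most 1 and the singularity is integrable; where \<open>|v - vs| \<ge> 1\<close>, the power is at
  most 1 and the Gaussian is integrable.
\<close>
lemma riesz_potential_gaussian_bounded:
  assumes "0 < \<beta>" "0 \<le> lam" "lam < 3"
  obtains C where "0 < C"
    "\<And>v :: vec3. (\<integral>\<^sup>+vs. ennreal (norm (v - vs) powr (- lam) * exp (- \<beta> * (norm vs)\<^sup>2)) \<partial>lborel)
        \<le> ennreal C"
proof -
  define s where "s = (\<lambda>u :: vec3. ennreal (norm u powr (- lam)) * indicator (ball 0 1) u)"
  define G where "G = (\<lambda>u :: vec3. ennreal (exp (- \<beta> * (norm u)\<^sup>2)))"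
  have ball [measurable]: "ball (0::vec3) 1 \<in> sets borel" by simp
  have s [measurable]: "s \<in> borel_measurable borel"
    unfolding s_def
    by (intro borel_measurable_times_ennreal borel_measurable_indicator ball) measurable
  have [measurable]: "G \<in> borel_measurable borel" unfolding G_def by measurable
  have "integral\<^sup>N lborel s + integral\<^sup>N lborel G < \<infinity>"
    using nn_integral_singularity_finite[OF assms(2,3)] nn_integral_gaussian_finite[OF assms(1)]
    by (simp add: s_def G_def)
  then obtain C where C: "integral\<^sup>N lborel s + integral\<^sup>N lborel G = ennreal C" "0 \<le> C"
    by (metis ennreal_cases infinity_ennreal_def less_irrefl)
  have "(\<integral>\<^sup>+vs. ennreal (norm (v - vs) powr (- lam) * exp (- \<beta> * (norm vs)\<^sup>2)) \<partial>lborel)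
      \<le> ennreal (C + 1)" for v :: vec3
  proof -
    have "(\<integral>\<^sup>+vs. ennreal (norm (v - vs) powr (- lam) * exp (- \<beta> * (norm vs)\<^sup>2)) \<partial>lborel)
        \<le> (\<integral>\<^sup>+vs. s (vs + - v) + G vs \<partial>lborel)"
    proof (rule nn_integral_mono)
      fix vs :: vec3
      have nm: "norm (v - vs) = norm (vs + - v)" by (simp add: norm_minus_commute)
      show "ennreal (norm (v - vs) powr (- lam) * exp (- \<beta> * (norm vs)\<^sup>2)) \<le> s (vs + - v) + G vs"
      proof (cases "norm (vs + - v) < 1")
        case True
        have "norm (vs + - v) powr (- lam) * exp (- \<beta> * (norm vs)\<^sup>2) \<le> norm (vs + - v) powr (- lam) * 1"
          using assms(1) by (intro mult_left_mono) auto
        then have "ennreal (norm (v - vs) powr (- lam) * exp (- \<beta> * (norm vs)\<^sup>2)) \<le> s (vs + - v)"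
          using True unfolding s_def nm by (simp add: ennreal_leI)
        then show ?thesis by (simp add: add_increasing2)
      next
        case False
        then have "norm (vs + - v) powr (- lam) \<le> 1"
          using assms(2) powr_mono[of "- lam" 0 "norm (vs + - v)"]
            by (auto split: if_splits)
        then have "norm (vs + - v) powr (- lam) * exp (- \<beta> * (norm vs)\<^sup>2) \<le> 1 * exp (- \<beta> * (norm vs)\<^sup>2)"
          by (intro mult_right_mono) auto
        then have "ennreal (norm (v - vs) powr (- lam) * exp (- \<beta> * (norm vs)\<^sup>2)) \<le> G vs"
          unfolding G_def nm by (simp add: ennreal_leI)
        then show ?thesis by (simp add: add_increasing)
      qed
    qed
    also have "\<dots> = (\<integral>\<^sup>+vs. s (vs + - v) \<partial>lborel) + integral\<^sup>N lborel G"
      by (rule nn_integral_add) simp_all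
    also have "(\<integral>\<^sup>+vs. s (vs + - v) \<partial>lborel) = integral\<^sup>N lborel s"
      by (rule nn_integral_lborel_translate) simp
    also have "integral\<^sup>N lborel s + integral\<^sup>N lborel G \<le> ennreal (C + 1)"
      unfolding C(1) by (rule ennreal_leI) simp
    finally show ?thesis .
  qed
  with C(2) show ?thesis by (intro that[of "C + 1"]) auto
qed

section \<open>Weighted Lipschitz estimate for the collision operator\<close>

lemma product_difference_le:
  fixes a a' c c' :: real
  assumes "\<bar>a - c\<bar> \<le> n * p" "\<bar>a' - c'\<bar> \<le> n * q" "\<bar>a'\<bar> \<le> B * q" "\<bar>c\<bar> \<le> B * p"
  shows "\<bar>a * a' - c * c'\<bar> \<le> 2 * B * n * (p * q)"
proof -
  have "a * a' - c * c' = (a - c) * a' + c * (a' - c')" by (simp add: algebra_simps)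
  also have "\<bar>\<dots>\<bar> \<le> \<bar>a - c\<bar> * \<bar>a'\<bar> + \<bar>c\<bar> * \<bar>a' - c'\<bar>"
    by (metis abs_mult abs_triangle_ineq)
  also have "\<dots> \<le> (n * p) * (B * q) + (B * p) * (n * q)"
    using assms by (intro add_mono mult_mono) (auto intro: order_trans[OF abs_ge_zero])
  finally show ?thesis by (simp add: algebra_simps)
qed

lemma collision_op_translate: "collision_op b (translate y g) z = translate y (collision_op b g) z"
  by (cases z) (simp add: collision_op_def translate_def collision_integrand_def case_prod_beta)

lemma collision_integrand_translate:
  "collision_integrand b (translate y g) (x, v) = collision_integrand b g (x + y, v)"
  by (simp add: translate_def collision_integrand_def fun_eq_iff)

text \<open>
  Integrating first over the sphere turns the kernel into \<open>b0 |v - vs| powr (- lam)\<close>, except at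
  \<open>vs = v\<close>, which is a single point.
\<close>
lemma kernel_weighted_integral_le:
  assumes b: "collision_kernel b0 lam b" and b0: "0 \<le> b0" and A: "0 \<le> A"
    and W [measurable]: "W \<in> borel_measurable borel" and W0: "\<And>vs. 0 \<le> W vs"
    and C: "(\<integral>\<^sup>+vs. ennreal (norm (v - vs) powr (- lam) * W vs) \<partial>lborel) \<le> ennreal C"
  shows "(\<integral>\<^sup>+(vs, w). ennreal (b (norm (v - vs)) ((v - vs) \<bullet> w) * (A * W vs))
      \<partial>(lborel \<Otimes>\<^sub>M (sphere_measure :: vec3 measure))) \<le> ennreal (A * b0 * C)"
proof -
  have b_meas: "(\<lambda>(r, s). b r s) \<in> borel_measurable borel" and b_nn: "\<And>r s. 0 \<le> b r s"
    and b_int: "\<And>vs. v \<noteq> vs \<Longrightarrow> (\<integral>\<^sup>+w. ennreal (b (norm (v - vs)) ((v - vs) \<bullet> w)) \<partial>sphere_measure)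
          \<le> ennreal (b0 * norm (v - vs) powr (- lam))"
    using b by (auto simp: collision_kernel_def)
  have b_comp [measurable]: "(\<lambda>q. b (f q) (g q)) \<in> borel_measurable M"
    if [measurable]: "f \<in> borel_measurable M" "g \<in> borel_measurable M" for f g and M :: "'z measure"
    using measurable_compose[OF borel_measurable_Pair[OF that] b_meas] by simp
  have meas: "(\<lambda>(vs, w). ennreal (b (norm (v - vs)) ((v - vs) \<bullet> w) * (A * W vs)))
      \<in> borel_measurable (lborel \<Otimes>\<^sub>M (sphere_measure :: vec3 measure))"
    unfolding case_prod_beta by measurable
  have "(\<integral>\<^sup>+(vs, w). ennreal (b (norm (v - vs)) ((v - vs) \<bullet> w) * (A * W vs))
      \<partial>(lborel \<Otimes>\<^sub>M (sphere_measure :: vec3 measure)))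
    = (\<integral>\<^sup>+vs. \<integral>\<^sup>+w. ennreal (b (norm (v - vs)) ((v - vs) \<bullet> w) * (A * W vs)) \<partial>sphere_measure \<partial>lborel)"
    using sphere_measure.nn_integral_fst[OF meas] by simp
  also have "\<dots> \<le> (\<integral>\<^sup>+vs. ennreal (A * b0) * ennreal (norm (v - vs) powr (- lam) * W vs) \<partial>lborel)"
  proof (rule nn_integral_mono_AE)
    have "AE vs in lborel. vs \<noteq> v" by (rule AE_lborel_singleton)
    then show "AE vs in lborel.
        (\<integral>\<^sup>+w. ennreal (b (norm (v - vs)) ((v - vs) \<bullet> w) * (A * W vs)) \<partial>sphere_measure)
        \<le> ennreal (A * b0) * ennreal (norm (v - vs) powr (- lam) * W vs)"
    proof eventually_elim
      case (elim vs)
      have "(\<integral>\<^sup>+w. ennreal (b (norm (v - vs)) ((v - vs) \<bullet> w) * (A * W vs)) \<partial>sphere_measure)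
          = (\<integral>\<^sup>+w. ennreal (b (norm (v - vs)) ((v - vs) \<bullet> w)) * ennreal (A * W vs) \<partial>sphere_measure)"
        using A W0 b_nn by (intro nn_integral_cong) (simp add: ennreal_mult)
      also have "\<dots> = (\<integral>\<^sup>+w. ennreal (b (norm (v - vs)) ((v - vs) \<bullet> w)) \<partial>sphere_measure) * ennreal (A * W vs)"
        by (rule nn_integral_multc) measurable
      also have "\<dots> \<le> ennreal (b0 * norm (v - vs) powr (- lam)) * ennreal (A * W vs)"
        using elim by (intro mult_right_mono b_int) auto
      also have "\<dots> = ennreal (A * b0) * ennreal (norm (v - vs) powr (- lam) * W vs)"
        using A W0 b0 by (simp add: mult_ac flip: ennreal_mult)
      finally show ?case .
    qed
  qed
  also have "\<dots> = ennreal (A * b0) * (\<integral>\<^sup>+vs. ennreal (norm (v - vs) powr (- lam) * W vs) \<partial>lborel)"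
    by (rule nn_integral_cmult) measurable
  also have "\<dots> \<le> ennreal (A * b0) * ennreal C"
    by (rule mult_left_mono[OF C]) simp
  also have "\<dots> = ennreal (A * b0 * C)"
    using A b0 by (simp add: ennreal_mult')
  finally show ?thesis .
qed

text \<open>
  The integrand is bilinear, so the difference of two gain terms is at most
  \<open>2 B n W(v') W(vs')\<close>, and invariance of the weight turns this into \<open>2 B n W(v) W(vs)\<close>, the same
  bound as for the loss terms. The factor \<open>W(v)\<close> leaves the integral and \<open>W(vs)\<close> is absorbed by
  \<open>C\<close>. In particular the weight of the result is not worse than that of the difference.
\<close>
lemma collision_op_Lipschitz:
  assumes b: "collision_kernel b0 lam b" and b0: "0 \<le> b0" and B: "0 \<le> B" and n: "0 \<le> n"
    and W [measurable]: "W \<in> borel_measurable borel" and W0: "\<And>z. 0 \<le> W z"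
    and inv: "\<And>x v vs w. norm w = 1 \<Longrightarrow>
      W (x, post_v v vs w) * W (x, post_vs v vs w) = W (x, v) * W (x, vs)"
    and C0: "0 \<le> C"
    and C: "\<And>x v. (\<integral>\<^sup>+vs. ennreal (norm (v - vs) powr (- lam) * W (x, vs)) \<partial>lborel) \<le> ennreal C"
    and g: "AE z in lborel. \<bar>g z\<bar> \<le> B * W z" and h: "AE z in lborel. \<bar>h z\<bar> \<le> B * W z"
    and gh: "AE z in lborel. \<bar>g z - h z\<bar> \<le> n * W z"
    and ig: "AE z in lborel. integrable (lborel \<Otimes>\<^sub>M sphere_measure) (collision_integrand b g z)"
    and ih: "AE z in lborel. integrable (lborel \<Otimes>\<^sub>M sphere_measure) (collision_integrand b h z)"
  shows "AE z in lborel. \<bar>collision_op b g z - collision_op b h z\<bar> \<le> 4 * B * b0 * C * n * W z"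
proof -
  define P where "P z \<longleftrightarrow> \<bar>g z\<bar> \<le> B * W z \<and> \<bar>h z\<bar> \<le> B * W z \<and> \<bar>g z - h z\<bar> \<le> n * W z" for z
  have P: "AE z in lborel. P z" unfolding P_def using g h gh by eventually_elim auto
  show ?thesis
    using P AE_collision[OF P] ig ih
  proof eventually_elim
    case (elim z)
    obtain x v where z: "z = (x, v)" by (cases z)
    let ?M = "lborel \<Otimes>\<^sub>M (sphere_measure :: vec3 measure)"
    let ?g = "collision_integrand b g z" and ?h = "collision_integrand b h z"
    have b_nn: "\<And>r s. 0 \<le> b r s" using b by (auto simp: collision_kernel_def)
    have Wx: "(\<lambda>vs. W (x, vs)) \<in> borel_measurable borel" by measurable
    have pt: "AE (vs, w) in ?M. \<bar>?g (vs, w) - ?h (vs, w)\<bar>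
        \<le> b (norm (v - vs)) ((v - vs) \<bullet> w) * (4 * B * n * W (x, v) * W (x, vs))"
      using elim(2) unfolding z prod.case
    proof eventually_elim
      case (elim p)
      obtain vs w where p: "p = (vs, w)" by (cases p)
      have Pp: "norm w = 1" "P (x, vs)" "P (x, post_v v vs w)" "P (x, post_vs v vs w)"
        using elim by (auto simp: p)
      have "\<bar>g (x, post_v v vs w) * g (x, post_vs v vs w) - h (x, post_v v vs w) * h (x, post_vs v vs w)\<bar>
          \<le> 2 * B * n * (W (x, post_v v vs w) * W (x, post_vs v vs w))"
        using Pp unfolding P_def by (intro product_difference_le) auto
      moreover have "\<bar>g (x, v) * g (x, vs) - h (x, v) * h (x, vs)\<bar>
          \<le> 2 * B * n * (W (x, v) * W (x, vs))"
        using Pp(2) \<open>P z\<close> unfolding P_def z by (intro product_difference_le) auto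
      ultimately have "\<bar>(g (x, post_v v vs w) * g (x, post_vs v vs w) - g (x, v) * g (x, vs))
          - (h (x, post_v v vs w) * h (x, post_vs v vs w) - h (x, v) * h (x, vs))\<bar>
          \<le> 4 * B * n * W (x, v) * W (x, vs)"
        unfolding inv[OF Pp(1)] by linarith
      from mult_left_mono[OF this b_nn[of "norm (v - vs)" "(v - vs) \<bullet> w"]]
      show ?case
        by (simp add: p collision_integrand_def abs_mult b_nn flip: right_diff_distrib)
    qed
    have "ennreal \<bar>collision_op b g z - collision_op b h z\<bar> = norm (\<integral>p. ?g p - ?h p \<partial>?M)"
      using elim(3,4) by (simp add: collision_op_def)
    also have "\<dots> \<le> (\<integral>\<^sup>+p. norm (?g p - ?h p) \<partial>?M)"
      using elim(3,4) by (intro integral_norm_bound_ennreal) simp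
    also have "\<dots> \<le> (\<integral>\<^sup>+(vs, w). ennreal (b (norm (v - vs)) ((v - vs) \<bullet> w)
        * (4 * B * n * W (x, v) * W (x, vs))) \<partial>?M)"
    proof (rule nn_integral_mono_AE)
      show "AE p in ?M. ennreal (norm (?g p - ?h p)) \<le> (case p of (vs, w) \<Rightarrow>
          ennreal (b (norm (v - vs)) ((v - vs) \<bullet> w) * (4 * B * n * W (x, v) * W (x, vs))))"
        using pt by eventually_elim (auto intro: ennreal_leI)
    qed
    also have "\<dots> \<le> ennreal (4 * B * n * W (x, v) * b0 * C)"
      by (rule kernel_weighted_integral_le[OF b b0 _ Wx W0 C]) (simp add: B n W0)
    finally have "\<bar>collision_op b g z - collision_op b h z\<bar> \<le> 4 * B * n * W (x, v) * b0 * C"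
      by (subst (asm) ennreal_le_iff) (simp_all add: B n W0 b0 C0)
    then show ?case by (simp add: z mult_ac)
  qed
qed

section \<open>Translation differences of the Duhamel integral\<close>

lemma translate_L1:
  assumes "integrable lborel g"
  shows "integrable lborel (translate y g)" and "L1_norm (translate y g) = L1_norm g"
proof -
  have tr: "translate y g = (\<lambda>z. g ((y, 0) + z))"
    by (auto simp: translate_def fun_eq_iff add.commute)
  have [measurable]: "g \<in> borel_measurable borel" using assms by auto
  have "integrable (distr lborel borel ((+) (y, 0))) g"
    using assms by (simp add: lborel_distr_plus)
  then show "integrable lborel (translate y g)"
    unfolding tr by (subst (asm) integrable_distr_eq) auto
  have "L1_norm g = (\<integral>z. \<bar>g z\<bar> \<partial>distr lborel borel ((+) (y, 0)))"
    by (simp add: L1_norm_def lborel_distr_plus)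
  also have "\<dots> = L1_norm (translate y g)"
    unfolding tr L1_norm_def by (subst integral_distr) auto
  finally show "L1_norm (translate y g) = L1_norm g" ..
qed

text \<open>
  The excess of \<open>|D|\<close> over \<open>W\<close> is dominated by \<open>|S - D|\<close> for every approximant \<open>S\<close>, so its integral
  vanishes. This passes pointwise bounds from Riemann sums to their limit in \<open>L\<^sup>1\<close>.
\<close>
lemma AE_bound_of_L1_limit:
  fixes D :: "phase \<Rightarrow> real"
  assumes D: "integrable lborel D" and W [measurable]: "W \<in> borel_measurable borel"
    and approx: "\<And>\<delta>. 0 < \<delta> \<Longrightarrow> \<exists>S. integrable lborel S \<and> L1_norm (\<lambda>z. S z - D z) < \<delta> \<and>
      (AE z in lborel. \<bar>S z\<bar> \<le> W z)"
  shows "AE z in lborel. \<bar>D z\<bar> \<le> W z"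
proof -
  have [measurable]: "D \<in> borel_measurable borel" using D by auto
  let ?E = "\<lambda>z. ennreal (\<bar>D z\<bar> - W z)"
  have "integral\<^sup>N lborel ?E \<le> 0"
  proof (rule ennreal_le_epsilon)
    fix \<delta> :: real assume "0 < \<delta>"
    then obtain S where S: "integrable lborel S" "L1_norm (\<lambda>z. S z - D z) < \<delta>"
      "AE z in lborel. \<bar>S z\<bar> \<le> W z" using approx by blast
    have "integral\<^sup>N lborel ?E \<le> (\<integral>\<^sup>+z. ennreal \<bar>S z - D z\<bar> \<partial>lborel)"
    proof (rule nn_integral_mono_AE)
      show "AE z in lborel. ?E z \<le> ennreal \<bar>S z - D z\<bar>"
        using S(3) by eventually_elim (auto intro!: ennreal_leI)
    qed
    also have "\<dots> = ennreal (L1_norm (\<lambda>z. S z - D z))"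
      unfolding L1_norm_def using S(1) D by (intro nn_integral_eq_integral) auto
    finally show "integral\<^sup>N lborel ?E \<le> 0 + ennreal \<delta>"
      using ennreal_leI[OF less_imp_le[OF S(2)]] by simp
  qed
  then have "AE z in lborel. ?E z = 0"
    by (subst nn_integral_0_iff_AE[symmetric]) auto
  then show ?thesis by eventually_elim (simp add: ennreal_eq_0_iff)
qed

text \<open>
  The integral of \<open>exp (L s)\<close> over \<open>[0, t]\<close> is \<open>(exp (L t) - 1) / L\<close>; the missing \<open>1 / L\<close> leaves room for
  the error of the Riemann sum, so that the bound is free of any epsilon.
\<close>
lemma fine_division_exp_sum:
  fixes L t \<delta> :: real
  assumes "0 < L" "0 \<le> t" "0 < \<delta>"
  obtains p where "p tagged_division_of {0..t}" "(\<lambda>s. ball s \<delta>) fine p"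
    "(\<Sum>(s, K)\<in>p. measure lborel K * exp (L * s)) \<le> exp (L * t) / L"
proof -
  have "((\<lambda>s. exp (L * s)) has_integral (exp (L * t) / L - exp (L * 0) / L)) {0..t}"
    using assms
    by (intro fundamental_theorem_of_calculus)
       (auto intro!: derivative_eq_intros simp flip: has_real_derivative_iff_has_vector_derivative)
  from this[unfolded has_integral_real, rule_format, of "1 / L"] obtain \<gamma> where
    \<gamma>: "gauge \<gamma>" "\<And>p. p tagged_division_of {0..t} \<Longrightarrow> \<gamma> fine p \<Longrightarrow>
      norm ((\<Sum>(s, K)\<in>p. measure lborel K *\<^sub>R exp (L * s)) - (exp (L * t) / L - exp (L * 0) / L)) < 1 / L"
    using assms(1) by auto
  have "gauge (\<lambda>s. ball s \<delta>)" using assms(3) by (rule gauge_ball)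
  with \<gamma>(1) have "gauge (\<lambda>s. ball s \<delta> \<inter> \<gamma> s)" by (intro gauge_Int)
  then obtain p where p: "p tagged_division_of {0..t}" "(\<lambda>s. ball s \<delta> \<inter> \<gamma> s) fine p"
    by (rule fine_division_exists_real)
  then have "(\<lambda>s. ball s \<delta>) fine p" "\<gamma> fine p" by (auto simp: fine_Int)
  moreover have "(\<Sum>(s, K)\<in>p. measure lborel K * exp (L * s)) \<le> exp (L * t) / L"
    using \<gamma>(2)[OF p(1) \<open>\<gamma> fine p\<close>] by simp
  ultimately show ?thesis using p(1) that by blast
qed

text \<open>
  The translation difference of the integral is the limit of those of the Riemann sums, each of which
  obeys the pointwise bound with a Riemann sum of \<open>exp (L s)\<close> as coefficient.
\<close>
lemma Riemann_integral_translation_bound: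
  assumes int: "L1_has_Riemann_integral F I {0..t}" and t: "0 \<le> t" and L: "0 < L" and a: "0 \<le> a"
    and W [measurable]: "W \<in> borel_measurable borel" and W0: "\<And>z. 0 \<le> W z"
    and F: "\<And>s. s \<in> {0..t} \<Longrightarrow>
      AE z in lborel. \<bar>translate y (F s) z - F s z\<bar> \<le> a * exp (L * s) * W z"
  shows "AE z in lborel. \<bar>translate y I z - I z\<bar> \<le> a / L * exp (L * t) * W z"
proof (rule AE_bound_of_L1_limit)
  have Fi: "\<And>s. s \<in> {0..t} \<Longrightarrow> integrable lborel (F s)" and I: "integrable lborel I"
    using int by (auto simp: L1_has_Riemann_integral_def L1_def)
  show "integrable lborel (\<lambda>z. translate y I z - I z)"
    using I translate_L1(1)[OF I] by simp
  fix \<delta> :: real assume \<delta>: "0 < \<delta>"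
  then have "0 < \<delta> / 2" by simp
  then obtain d where d: "0 < d" "\<And>p. p tagged_division_of {0..t} \<Longrightarrow> (\<lambda>s. ball s d) fine p \<Longrightarrow>
        L1_norm (\<lambda>z. (\<Sum>(s, K)\<in>p. measure lborel K * F s z) - I z) < \<delta> / 2"
    using int unfolding L1_has_Riemann_integral_def by blast
  obtain p where p: "p tagged_division_of {0..t}" "(\<lambda>s. ball s d) fine p"
    "(\<Sum>(s, K)\<in>p. measure lborel K * exp (L * s)) \<le> exp (L * t) / L"
    by (rule fine_division_exp_sum[OF L t d(1)])
  have fin: "finite p" and tag: "\<And>s K. (s, K) \<in> p \<Longrightarrow> s \<in> {0..t}"
    using p(1) by (auto dest: tag_in_interval)
  define R where "R z = (\<Sum>(s, K)\<in>p. measure lborel K * F s z)" for z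
  define G where "G z = R z - I z" for z
  have R: "integrable lborel R"
    unfolding R_def case_prod_beta using tag by (intro Bochner_Integration.integrable_sum integrable_mult_right Fi) auto
  then have G: "integrable lborel G" unfolding G_def using I by auto
  have TG: "integrable lborel (translate y G)" by (rule translate_L1(1)[OF G])
  show "\<exists>S. integrable lborel S \<and> L1_norm (\<lambda>z. S z - (translate y I z - I z)) < \<delta> \<and>
      (AE z in lborel. \<bar>S z\<bar> \<le> a / L * exp (L * t) * W z)"
  proof (intro exI conjI)
    let ?S = "\<lambda>z. translate y R z - R z"
    show "integrable lborel ?S" using R translate_L1(1)[OF R] by simp
    have "(\<lambda>z. ?S z - (translate y I z - I z)) = (\<lambda>z. translate y G z - G z)"
      by (auto simp: G_def translate_def fun_eq_iff)
    then have "L1_norm (\<lambda>z. ?S z - (translate y I z - I z)) = (\<integral>z. \<bar>translate y G z - G z\<bar> \<partial>lborel)"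
      by (simp add: L1_norm_def)
    also have "\<dots> \<le> (\<integral>z. \<bar>translate y G z\<bar> + \<bar>G z\<bar> \<partial>lborel)"
      using G TG by (intro integral_mono) auto
    also have "\<dots> = L1_norm (translate y G) + L1_norm G"
      unfolding L1_norm_def using G TG by (intro Bochner_Integration.integral_add) auto
    also have "\<dots> = 2 * L1_norm G" by (simp add: translate_L1(2)[OF G])
    also have "\<dots> < \<delta>" using d(2)[OF p(1,2)] by (simp add: G_def[abs_def] R_def)
    finally show "L1_norm (\<lambda>z. ?S z - (translate y I z - I z)) < \<delta>" .
    have "AE z in lborel. \<forall>q\<in>p. \<bar>translate y (F (fst q)) z - F (fst q) z\<bar> \<le> a * exp (L * fst q) * W z"
      using fin tag by (intro AE_finite_allI F) auto
    then show "AE z in lborel. \<bar>?S z\<bar> \<le> a / L * exp (L * t) * W z"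
    proof eventually_elim
      case (elim z)
      have "?S z = (\<Sum>q\<in>p. measure lborel (snd q) * (translate y (F (fst q)) z - F (fst q) z))"
        by (simp add: R_def translate_def case_prod_beta sum_subtractf right_diff_distrib)
      also have "\<bar>\<dots>\<bar> \<le> (\<Sum>q\<in>p. \<bar>measure lborel (snd q) * (translate y (F (fst q)) z - F (fst q) z)\<bar>)"
        by (rule sum_abs)
      also have "\<dots> \<le> (\<Sum>q\<in>p. measure lborel (snd q) * (a * exp (L * fst q) * W z))"
        using elim by (intro sum_mono) (simp add: abs_mult mult_left_mono)
      also have "\<dots> = a * W z * (\<Sum>(s, K)\<in>p. measure lborel K * exp (L * s))"
        by (simp add: sum_distrib_left case_prod_beta mult_ac)
      also have "\<dots> \<le> a * W z * (exp (L * t) / L)"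
        using p(3) a W0 by (intro mult_left_mono) auto
      finally show ?case by (simp add: mult_ac)
    qed
  qed
qed measurable

section \<open>Propagation of Lipschitz regularity along mild solutions\<close>

text \<open>
  One round of Gronwall's argument. By Duhamel's formula the difference at time \<open>t\<close> is the transported
  initial difference plus the integral of the transported differences of \<open>J\<close>. The weight is carried
  along by the flow, and \<open>J\<close> has Lipschitz constant \<open>L / 2\<close>, while integrating \<open>exp (L s)\<close> gains
  \<open>1 / L\<close>: thus an arbitrary constant \<open>c\<close> is improved to \<open>n + c / 2\<close>.
\<close>
lemma mild_solution_translation_improve:
  assumes mild: "mild_solution b T f0 f" and b: "collision_kernel b0 lam b"
    and b0: "0 < b0" and B: "0 < B" and C0: "0 < C"
    and C: "\<And>v :: vec3. (\<integral>\<^sup>+vs. ennreal (norm (v - vs) powr (- lam) * exp (- \<beta> * (norm vs)\<^sup>2)) \<partial>lborel)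
        \<le> ennreal C"
    and \<beta>: "0 \<le> \<beta>" and L: "L = 8 * B * b0 * C"
    and f: "\<And>s. s \<in> {0..T} \<Longrightarrow> AE z in lborel. \<bar>f s z\<bar> \<le> B * moving_Maxwellian \<beta> s z"
    and Tf: "\<And>s. s \<in> {0..T} \<Longrightarrow> AE z in lborel. \<bar>translate y (f s) z\<bar> \<le> B * moving_Maxwellian \<beta> s z"
    and init: "AE z in lborel. \<bar>translate y f0 z - f0 z\<bar> \<le> n * moving_Maxwellian \<beta> 0 z"
    and n: "0 \<le> n" and c: "0 \<le> c"
    and bound: "\<And>s. s \<in> {0..T} \<Longrightarrow>
      AE z in lborel. \<bar>translate y (f s) z - f s z\<bar> \<le> c * exp (L * s) * moving_Maxwellian \<beta> s z"
    and t: "t \<in> {0..T}"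
  shows "AE z in lborel. \<bar>translate y (f t) z - f t z\<bar>
    \<le> (n + c / 2) * exp (L * t) * moving_Maxwellian \<beta> t z"
proof -
  let ?W = "moving_Maxwellian \<beta>"
  let ?J = "\<lambda>s. collision_op b (f s)"
  let ?F = "\<lambda>s. free_flow (t - s) (?J s)"
  have Lpos: "0 < L" using B b0 C0 by (simp add: L)
  from mild t obtain I where
    int: "L1_has_Riemann_integral ?F I {0..t}"
    and eq: "AE z in lborel. f t z = free_flow t f0 z + I z"
    unfolding mild_solution_def by blast
  \<comment> \<open>The transported factor of the weight is at most 1, which leaves the velocity Gaussian.\<close>
  have CW: "(\<integral>\<^sup>+vs. ennreal (norm (v - vs) powr (- lam) * ?W s (x, vs)) \<partial>lborel) \<le> ennreal C"
    for x v :: vec3 and s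
  proof (rule order_trans[OF nn_integral_mono C[of v]])
    fix vs
    show "ennreal (norm (v - vs) powr (- lam) * ?W s (x, vs))
        \<le> ennreal (norm (v - vs) powr (- lam) * exp (- \<beta> * (norm vs)\<^sup>2))"
      using \<beta> by (intro ennreal_leI mult_left_mono) (auto simp: moving_Maxwellian_eq algebra_simps)
  qed
  have J: "AE z in lborel. \<bar>translate y (?J s) z - ?J s z\<bar> \<le> L / 2 * c * exp (L * s) * ?W s z"
    if s: "s \<in> {0..T}" for s
  proof -
    let ?i = "\<lambda>g z. integrable (lborel \<Otimes>\<^sub>M sphere_measure) (collision_integrand b g z)"
    have 1: "AE z in lborel. ?i (f s) z"
      using mild s by (auto simp: mild_solution_def collision_dom_def)
    have 2: "AE z in lborel. ?i (translate y (f s)) z"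
      using AE_translate[OF 1, of y]
      by eventually_elim (auto simp: collision_integrand_translate split: prod.splits)
    have "AE z in lborel. \<bar>collision_op b (translate y (f s)) z - ?J s z\<bar>
        \<le> 4 * B * b0 * C * (c * exp (L * s)) * ?W s z"
      using c b0 B C0
      by (intro collision_op_Lipschitz[OF b _ _ _ _ moving_Maxwellian_nonneg
            moving_Maxwellian_collision _ CW Tf[OF s] f[OF s] bound[OF s] 2 1]) auto
    then show ?thesis
      by eventually_elim (simp add: collision_op_translate L mult_ac)
  qed
  have "AE z in lborel. \<bar>translate y (?F s) z - ?F s z\<bar> \<le> (L / 2 * c) * exp (L * s) * ?W t z"
    if "s \<in> {0..t}" for s
  proof -
    have "s \<in> {0..T}" using that t by auto
    from AE_free_flow[OF J[OF this], of "t - s"] show ?thesis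
    proof eventually_elim
      case (elim z)
      obtain x v where z: "z = (x, v)" by (cases z)
      show ?case
        using elim unfolding z prod.case moving_Maxwellian_flow
        by (simp add: free_flow_def translate_def algebra_simps)
    qed
  qed
  then have I: "AE z in lborel. \<bar>translate y I z - I z\<bar> \<le> (L / 2 * c) / L * exp (L * t) * ?W t z"
    using t Lpos c
    by (intro Riemann_integral_translation_bound[OF int] moving_Maxwellian_nonneg) auto
  have "(L / 2 * c) / L = c / 2" using Lpos by simp
  note I = I[unfolded this]
  have eqT: "AE z in lborel. translate y (f t) z = translate y (free_flow t f0) z + translate y I z"
    using AE_translate[OF eq, of y] by eventually_elim (auto simp: translate_def)
  have U: "AE z in lborel. \<bar>translate y (free_flow t f0) z - free_flow t f0 z\<bar> \<le> n * ?W t z"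
    using AE_free_flow[OF init, of t]
  proof eventually_elim
    case (elim z)
    obtain x v where z: "z = (x, v)" by (cases z)
    show ?case
      using elim moving_Maxwellian_flow[of \<beta> 0 x t v] unfolding z prod.case
      by (simp add: free_flow_def translate_def algebra_simps)
  qed
  from I eq eqT U show ?thesis
  proof eventually_elim
    case (elim z)
    have "1 \<le> exp (L * t)" using Lpos t by simp
    then have "n * ?W t z * 1 \<le> n * ?W t z * exp (L * t)"
      using n moving_Maxwellian_nonneg by (intro mult_left_mono) auto
    moreover have "(n + c / 2) * exp (L * t) * ?W t z
        = n * ?W t z * exp (L * t) + c / 2 * exp (L * t) * ?W t z"
      by (simp add: algebra_simps)
    ultimately show ?case
      using elim by linarith
  qed
qed

text \<open>
  Starting from the trivial bound \<open>|T\<^sub>y f| + |f| \<le> 2 B W\<close>, the map \<open>c \<mapsto> n + c / 2\<close> is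
  iterated towards its fixed point \<open>2 n\<close>. Each round treats all times at once, so the weighted norm
  of the difference is never integrated as a function of time.
\<close>
lemma mild_solution_translation_estimate:
  assumes mild: "mild_solution b T f0 f" and b: "collision_kernel b0 lam b"
    and b0: "0 < b0" and B: "0 < B" and C0: "0 < C"
    and C: "\<And>v :: vec3. (\<integral>\<^sup>+vs. ennreal (norm (v - vs) powr (- lam) * exp (- \<beta> * (norm vs)\<^sup>2)) \<partial>lborel)
        \<le> ennreal C"
    and \<beta>: "0 \<le> \<beta>" and L: "L = 8 * B * b0 * C"
    and f: "\<And>s. s \<in> {0..T} \<Longrightarrow> AE z in lborel. \<bar>f s z\<bar> \<le> B * moving_Maxwellian \<beta> s z"
    and Tf: "\<And>s. s \<in> {0..T} \<Longrightarrow> AE z in lborel. \<bar>translate y (f s) z\<bar> \<le> B * moving_Maxwellian \<beta> s z"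
    and init: "AE z in lborel. \<bar>translate y f0 z - f0 z\<bar> \<le> n * moving_Maxwellian \<beta> 0 z"
    and n: "0 \<le> n" and t: "t \<in> {0..T}"
  shows "AE z in lborel. \<bar>translate y (f t) z - f t z\<bar>
    \<le> 2 * n * exp (L * t) * moving_Maxwellian \<beta> t z"
proof -
  let ?W = "moving_Maxwellian \<beta>"
  have Lpos: "0 < L" using B b0 C0 by (simp add: L)
  have iter: "\<forall>s\<in>{0..T}. AE z in lborel. \<bar>translate y (f s) z - f s z\<bar>
      \<le> (2 * n + 2 * B * (1 / 2) ^ k) * exp (L * s) * ?W s z" for k
  proof (induction k)
    case 0
    show ?case
    proof
      fix s assume s: "s \<in> {0..T}"
      show "AE z in lborel. \<bar>translate y (f s) z - f s z\<bar>
        \<le> (2 * n + 2 * B * (1 / 2) ^ 0) * exp (L * s) * ?W s z"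
        using f[OF s] Tf[OF s]
      proof eventually_elim
        case (elim z)
        have "1 \<le> exp (L * s)" using Lpos s by simp
        then have "2 * B * 1 * ?W s z \<le> (2 * n + 2 * B) * exp (L * s) * ?W s z"
          using n B moving_Maxwellian_nonneg by (intro mult_right_mono mult_mono) auto
        then show ?case using elim by simp
      qed
    qed
  next
    case (Suc k)
    show ?case
    proof
      fix s assume s: "s \<in> {0..T}"
      have "AE z in lborel. \<bar>translate y (f s) z - f s z\<bar>
          \<le> (n + (2 * n + 2 * B * (1 / 2) ^ k) / 2) * exp (L * s) * ?W s z"
        using n B Suc
        by (intro mild_solution_translation_improve[OF mild b b0 B C0 C \<beta> L f Tf init n _ _ s]) auto
      then show "AE z in lborel. \<bar>translate y (f s) z - f s z\<bar>
          \<le> (2 * n + 2 * B * (1 / 2) ^ Suc k) * exp (L * s) * ?W s z"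
        by (simp add: add_divide_distrib)
    qed
  qed
  have "AE z in lborel. \<forall>k. \<bar>translate y (f t) z - f t z\<bar>
      \<le> (2 * n + 2 * B * (1 / 2) ^ k) * exp (L * t) * ?W t z"
    using iter t by (simp add: AE_all_countable)
  then show ?thesis
  proof eventually_elim
    case (elim z)
    have "(\<lambda>k. (2 * n + 2 * B * (1 / 2) ^ k) * exp (L * t) * ?W t z)
        \<longlonglongrightarrow> (2 * n + 2 * B * 0) * exp (L * t) * ?W t z"
      by (intro tendsto_intros LIMSEQ_power_zero) simp
    then show ?case
      using elim by (intro LIMSEQ_le_const[of _ _ "\<bar>translate y (f t) z - f t z\<bar>"]) auto
  qed
qed

theorem theorem2:
  fixes \<tau>s T \<tau>1 :: real
  assumes "0 < \<tau>s" and "0 < T" and "0 < \<tau>1" and "\<tau>1 < \<tau>s"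
  shows "\<exists>\<tau>. 0 < \<tau> \<and> \<tau> < \<tau>s \<and>
    (\<forall>R M0 b0 lam :: real. 0 < R \<longrightarrow> 0 < M0 \<longrightarrow> 0 < b0 \<longrightarrow> 0 \<le> lam \<longrightarrow> lam < 2 \<longrightarrow>
      (\<exists>M>0. \<forall>b f0 f.
        collision_kernel b0 lam b \<longrightarrow>
        mild_solution b T f0 f \<longrightarrow>
        (\<forall>t\<in>{0..T}. f t \<in> Maxw_pos \<tau>s \<and> Maxw_norm \<tau>s (f t) \<le> ereal R) \<longrightarrow>
        f0 \<in> Maxw_Lip \<tau>s R M0 \<longrightarrow>
        (\<forall>t\<in>{0..T}. f t \<in> Maxw_Lip \<tau> R M)))"
proof -
  define \<beta> where "\<beta> = \<tau>s / (4 * (1 + T\<^sup>2))"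
  define \<tau> where "\<tau> = \<beta> / (2 * (1 + T\<^sup>2))"
  have T1: "1 \<le> 1 + T\<^sup>2" by simp
  have \<beta>: "0 < \<beta>" "\<beta> \<le> \<tau>s"
    unfolding \<beta>_def using assms(1) T1 by (auto simp: divide_le_eq add_pos_nonneg)
  have \<tau>: "0 < \<tau>" "\<tau> < \<beta>"
    unfolding \<tau>_def using \<beta>(1) T1 by (auto simp: divide_less_eq add_pos_nonneg)
  show ?thesis
  proof (rule exI[of _ \<tau>], intro conjI allI impI)
    show "0 < \<tau>" "\<tau> < \<tau>s" using \<tau> \<beta> by auto
    fix R M0 b0 lam :: real
    assume R: "0 < R" and M0: "0 < M0" and b0: "0 < b0" and lam: "0 \<le> lam" "lam < 2"
    have "lam < 3" using lam by simp
    then obtain C where C: "0 < C" "\<And>v :: vec3.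
        (\<integral>\<^sup>+vs. ennreal (norm (v - vs) powr (- lam) * exp (- \<beta> * (norm vs)\<^sup>2)) \<partial>lborel) \<le> ennreal C"
      using riesz_potential_gaussian_bounded[OF \<beta>(1) lam(1)] by blast
    \<comment> \<open>The factor \<open>exp \<tau>s\<close> is the price of a shift by at most 1.\<close>
    define B where "B = R * exp \<tau>s"
    define L where "L = 8 * B * b0 * C"
    have B: "0 < B" using R by (simp add: B_def)
    have L: "0 < L" using B b0 C by (simp add: L_def)
    show "\<exists>M>0. \<forall>b f0 f. collision_kernel b0 lam b \<longrightarrow> mild_solution b T f0 f \<longrightarrow>
        (\<forall>t\<in>{0..T}. f t \<in> Maxw_pos \<tau>s \<and> Maxw_norm \<tau>s (f t) \<le> ereal R) \<longrightarrow>
        f0 \<in> Maxw_Lip \<tau>s R M0 \<longrightarrow> (\<forall>t\<in>{0..T}. f t \<in> Maxw_Lip \<tau> R M)"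
    proof (intro exI[of _ "2 * M0 * exp (L * T)"] conjI allI impI ballI)
      show "0 < 2 * M0 * exp (L * T)" using M0 by simp
      fix b f0 f t
      assume b: "collision_kernel b0 lam b" and mild: "mild_solution b T f0 f"
        and f: "\<forall>t\<in>{0..T}. f t \<in> Maxw_pos \<tau>s \<and> Maxw_norm \<tau>s (f t) \<le> ereal R"
        and f0: "f0 \<in> Maxw_Lip \<tau>s R M0" and t: "t \<in> {0..T}"
      have fR: "AE z in lborel. \<bar>f s z\<bar> \<le> R * gauss_weight \<tau>s \<tau>s z" if "s \<in> {0..T}" for s
        using f that by (intro Maxw_norm_leD) auto
      have f_meas: "f t \<in> borel_measurable borel"
        using f t by (auto simp: Maxw_pos_def Maxw_def Linf_def)
      have Tf: "AE z in lborel. \<bar>translate y (f s) z\<bar> \<le> B * moving_Maxwellian \<beta> s z"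
        if s: "s \<in> {0..T}" and y: "norm y \<le> 1" for s y
        using AE_translate[OF fR[OF s], of y]
      proof eventually_elim
        case (elim z)
        obtain x v where z: "z = (x, v)" by (cases z)
        have "R * gauss_weight \<tau>s \<tau>s (x + y, v) \<le> R * (exp \<tau>s * moving_Maxwellian \<beta> s (x, v))"
          using R s by (intro mult_left_mono gauss_weight_translate_le[OF assms(1) y \<beta>_def]) auto
        then show ?case using elim by (simp add: z translate_def B_def)
      qed
      have "translate 0 g = g" for g by (auto simp: translate_def fun_eq_iff)
      then have fB: "AE z in lborel. \<bar>f s z\<bar> \<le> B * moving_Maxwellian \<beta> s z" if "s \<in> {0..T}" for s
        using Tf[OF that, of 0] by simp
      have norm_R: "Maxw_norm \<tau> (f t) \<le> ereal R"
      proof (rule Maxw_norm_leI[OF f_meas])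
        show "AE z in lborel. \<bar>f t z\<bar> \<le> R * gauss_weight \<tau> \<tau> z"
          using fR[OF t]
        proof eventually_elim
          case (elim z)
          have "gauss_weight \<tau>s \<tau>s z \<le> gauss_weight \<tau> \<tau> z"
            using \<tau> \<beta> by (intro gauss_weight_antimono) auto
          then show ?case using elim R by (meson mult_left_mono less_imp_le order_trans)
        qed
      qed
      show "f t \<in> Maxw_Lip \<tau> R (2 * M0 * exp (L * T))"
        unfolding Maxw_Lip_def mem_Collect_eq
      proof (intro conjI allI impI)
        show "Maxw_norm \<tau> (f t) \<le> ereal R" by (rule norm_R)
        then show "f t \<in> Maxw \<tau>"
          using f t by (auto simp: Maxw_def Maxw_pos_def intro: le_less_trans)
        fix y :: vec3 assume y: "norm y \<le> 1"
        let ?n = "M0 * norm y"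
        have "AE z in lborel. \<bar>translate y f0 z - f0 z\<bar> \<le> ?n * gauss_weight \<tau>s \<tau>s z"
          using f0 y by (intro Maxw_norm_leD) (auto simp: Maxw_Lip_def)
        then have init: "AE z in lborel. \<bar>translate y f0 z - f0 z\<bar> \<le> ?n * moving_Maxwellian \<beta> 0 z"
        proof eventually_elim
          case (elim z)
          have "?n * gauss_weight \<tau>s \<tau>s z \<le> ?n * moving_Maxwellian \<beta> 0 z"
            using M0 by (intro mult_left_mono gauss_weight_le_moving_Maxwellian_0[OF assms(1) \<beta>_def]) auto
          then show ?case using elim by simp
        qed
        have n0: "0 \<le> ?n" using M0 by simp
        have est: "AE z in lborel. \<bar>translate y (f t) z - f t z\<bar>
            \<le> 2 * ?n * exp (L * t) * moving_Maxwellian \<beta> t z"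
          using \<beta>(1) by (intro mild_solution_translation_estimate[OF mild b b0 B C(1) C(2) _ L_def
                fB Tf[OF _ y] init n0 t]) auto
        show "Maxw_norm \<tau> (\<lambda>z. translate y (f t) z - f t z) \<le> ereal (2 * M0 * exp (L * T) * norm y)"
        proof (rule Maxw_norm_leI)
          show "(\<lambda>z. translate y (f t) z - f t z) \<in> borel_measurable borel"
          proof (rule borel_measurable_diff[OF _ f_meas])
            show "translate y (f t) \<in> borel_measurable borel"
              unfolding translate_def case_prod_beta
              by (intro measurable_compose[OF _ f_meas] borel_measurable_continuous_onI continuous_intros)
          qed
          show "AE z in lborel. \<bar>translate y (f t) z - f t z\<bar>
              \<le> 2 * M0 * exp (L * T) * norm y * gauss_weight \<tau> \<tau> z"
            using est
          proof eventually_elim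
            case (elim z)
            have "2 * ?n * exp (L * t) * moving_Maxwellian \<beta> t z
                \<le> 2 * ?n * exp (L * T) * gauss_weight \<tau> \<tau> z"
              using M0 L t
              by (intro mult_mono moving_Maxwellian_le_gauss_weight[OF \<beta>(1) \<tau>_def]
                    moving_Maxwellian_nonneg) auto
            then show ?case using elim by (simp add: mult_ac)
          qed
        qed
      qed
    qed
  qed
qed

end
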